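(* Let $\mathfrak{M}=(M,\mathcal{X})$ be a $\mathsf{B}\Sigma^0_2$-model and let $A\in\mathcal{X}$ be such that $\Sigma^0_2$-induction with parameter $A$ fails in $\mathfrak{M}$. If $G\subseteq M$ is $\Sigma^0_3(A)$ and $\mathfrak{M}[G]\models\mathsf{B}\Sigma^0_2$, then $G'\le_T A'$.
   Context: Work in second-order arithmetic. For $\mathfrak{M}=(M,\mathcal{X})$ and $A\subseteq M$, a set is $\Sigma^0_n(A)$ / $\Pi^0_n(A)$ if definable over $\mathfrak{M}$ by a $\Sigma^0_n$ / $\Pi^0_n$ formula with number parameters and $A$ as the only set parameter, and $\Delta^0_n(A)$ if both. For $X,Y\subseteq M$, $X\le_T Y$ means $X$ is $\Delta^0_1(Y)$. The Turing jump is $A'=\{e:\Phi^A_e(e)\downarrow\}$, where $\Phi_e$ is the $e$-th partial $\Sigma^0_1$-function with a set oracle. A $\mathsf{B}\Sigma^0_2$-model is a model of $\mathsf{RCA}_0+\mathsf{B}\Sigma^0_2$ in which $\mathsf{I}\Sigma^0_2$ fails. For $G\subseteq M$, $\mathfrak{M}[G]=(M,\{B:\exists C\in\mathcal{X}\,(B\in\Delta^0_1(C\oplus G))\})$. *)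

theory Defs
  imports Main
begin

text \<open>
  The first-order part of a model of second-order arithmetic is a type of the following class; its
  axioms are those of \<open>PA\<^sup>-\<close> (the non-negative part of a discretely ordered commutative ring).
  A structure \<open>(M, \<X>)\<close> is thus a type \<open>'m\<close> of this class together with \<open>\<X> :: 'm set set\<close>.
\<close>

class pa_minus = comm_semiring_1 + linordered_comm_semiring_strict + canonically_ordered_monoid_add +
  assumes discrete: "0 < x \<Longrightarrow> 1 \<le> x"


section \<open>Arithmetical formulas with set variables\<close>

text \<open>
  Number variables are de Bruijn indices and set variables are numbered. No formula quantifies
  over sets: the universal set quantifiers in front of the axiom schemes below range over \<open>\<X>\<close>
  and are expressed in HOL. The bound \<open>t\<close> in \<open>BForall t \<phi>\<close> and \<open>BExists t \<phi>\<close> lies outside the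
  scope of the quantifier.
\<close>

datatype tm = Var nat | Zero | One | Add tm tm | Mul tm tm

datatype fm =
    Eq tm tm | Less tm tm | Mem tm nat
  | Neg fm | Conj fm fm | Disj fm fm
  | BForall tm fm | BExists tm fm
  | Forall fm | Exists fm

definition scons :: "'a \<Rightarrow> (nat \<Rightarrow> 'a) \<Rightarrow> nat \<Rightarrow> 'a" (infixr "\<triangleright>" 65) where
  "a \<triangleright> v = (\<lambda>i. case i of 0 \<Rightarrow> a | Suc j \<Rightarrow> v j)"

primrec val :: "(nat \<Rightarrow> 'm::pa_minus) \<Rightarrow> tm \<Rightarrow> 'm" where
  "val v (Var i) = v i"
| "val v Zero = 0"
| "val v One = 1"
| "val v (Add s t) = val v s + val v t"
| "val v (Mul s t) = val v s * val v t"

primrec sat :: "(nat \<Rightarrow> 'm::pa_minus set) \<Rightarrow> (nat \<Rightarrow> 'm) \<Rightarrow> fm \<Rightarrow> bool" where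
  "sat S v (Eq s t) \<longleftrightarrow> val v s = val v t"
| "sat S v (Less s t) \<longleftrightarrow> val v s < val v t"
| "sat S v (Mem t k) \<longleftrightarrow> val v t \<in> S k"
| "sat S v (Neg \<phi>) \<longleftrightarrow> \<not> sat S v \<phi>"
| "sat S v (Conj \<phi> \<psi>) \<longleftrightarrow> sat S v \<phi> \<and> sat S v \<psi>"
| "sat S v (Disj \<phi> \<psi>) \<longleftrightarrow> sat S v \<phi> \<or> sat S v \<psi>"
| "sat S v (BForall t \<phi>) \<longleftrightarrow> (\<forall>x < val v t. sat S (x \<triangleright> v) \<phi>)"
| "sat S v (BExists t \<phi>) \<longleftrightarrow> (\<exists>x < val v t. sat S (x \<triangleright> v) \<phi>)"
| "sat S v (Forall \<phi>) \<longleftrightarrow> (\<forall>x. sat S (x \<triangleright> v) \<phi>)"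
| "sat S v (Exists \<phi>) \<longleftrightarrow> (\<exists>x. sat S (x \<triangleright> v) \<phi>)"

primrec bounded_fm :: "fm \<Rightarrow> bool" where
  "bounded_fm (Eq s t) \<longleftrightarrow> True"
| "bounded_fm (Less s t) \<longleftrightarrow> True"
| "bounded_fm (Mem t k) \<longleftrightarrow> True"
| "bounded_fm (Neg \<phi>) \<longleftrightarrow> bounded_fm \<phi>"
| "bounded_fm (Conj \<phi> \<psi>) \<longleftrightarrow> bounded_fm \<phi> \<and> bounded_fm \<psi>"
| "bounded_fm (Disj \<phi> \<psi>) \<longleftrightarrow> bounded_fm \<phi> \<and> bounded_fm \<psi>"
| "bounded_fm (BForall t \<phi>) \<longleftrightarrow> bounded_fm \<phi>"
| "bounded_fm (BExists t \<phi>) \<longleftrightarrow> bounded_fm \<phi>"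
| "bounded_fm (Forall \<phi>) \<longleftrightarrow> False"
| "bounded_fm (Exists \<phi>) \<longleftrightarrow> False"

text \<open>Blocks of like quantifiers, possibly empty, count as one alternation.\<close>

inductive sigma_fm :: "nat \<Rightarrow> fm \<Rightarrow> bool" and pi_fm :: "nat \<Rightarrow> fm \<Rightarrow> bool" where
  "bounded_fm \<phi> \<Longrightarrow> sigma_fm 0 \<phi>"
| "bounded_fm \<phi> \<Longrightarrow> pi_fm 0 \<phi>"
| "pi_fm n \<phi> \<Longrightarrow> sigma_fm (Suc n) \<phi>"
| "sigma_fm n \<phi> \<Longrightarrow> pi_fm (Suc n) \<phi>"
| "sigma_fm (Suc n) \<phi> \<Longrightarrow> sigma_fm (Suc n) (Exists \<phi>)"
| "pi_fm (Suc n) \<phi> \<Longrightarrow> pi_fm (Suc n) (Forall \<phi>)"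


section \<open>Definability and Turing reducibility\<close>

text \<open>
  The assignment \<open>v\<close> supplies the number parameters; every set variable denotes \<open>A\<close>.
\<close>

definition sigma_definable :: "nat \<Rightarrow> 'm::pa_minus set \<Rightarrow> 'm set \<Rightarrow> bool" where
  "sigma_definable n A B \<longleftrightarrow> (\<exists>\<phi> v. sigma_fm n \<phi> \<and> B = {x. sat (\<lambda>_. A) (x \<triangleright> v) \<phi>})"

definition pi_definable :: "nat \<Rightarrow> 'm::pa_minus set \<Rightarrow> 'm set \<Rightarrow> bool" where
  "pi_definable n A B \<longleftrightarrow> (\<exists>\<phi> v. pi_fm n \<phi> \<and> B = {x. sat (\<lambda>_. A) (x \<triangleright> v) \<phi>})"

definition delta_definable :: "nat \<Rightarrow> 'm::pa_minus set \<Rightarrow> 'm set \<Rightarrow> bool" where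
  "delta_definable n A B \<longleftrightarrow> sigma_definable n A B \<and> pi_definable n A B"

definition turing_le :: "'m::pa_minus set \<Rightarrow> 'm set \<Rightarrow> bool" (infix "\<le>\<^sub>T" 50) where
  "B \<le>\<^sub>T A \<longleftrightarrow> delta_definable 1 A B"

definition join :: "'m::pa_minus set \<Rightarrow> 'm set \<Rightarrow> 'm set" where
  "join C G = {2 * x | x. x \<in> C} \<union> {2 * x + 1 | x. x \<in> G}"

text \<open>The second-order part of \<open>(M, \<X>)[G]\<close>.\<close>

definition adjoin :: "'m::pa_minus set set \<Rightarrow> 'm set \<Rightarrow> 'm set set" where
  "adjoin \<X> G = {B. \<exists>C \<in> \<X>. delta_definable 1 (join C G) B}"


section \<open>Axiom schemes and theories\<close>

text \<open>
  In each scheme \<open>\<X>\<close> is the collection of sets that may be used as parameters: the second-order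
  part of the model, or \<open>{A}\<close> for the scheme with \<open>A\<close> as its only set parameter.
\<close>

definition sigma_induction :: "nat \<Rightarrow> 'm::pa_minus set set \<Rightarrow> bool" where
  "sigma_induction n \<X> \<longleftrightarrow>
    (\<forall>\<phi> S v. sigma_fm n \<phi> \<and> range S \<subseteq> \<X> \<and>
       sat S (0 \<triangleright> v) \<phi> \<and> (\<forall>x. sat S (x \<triangleright> v) \<phi> \<longrightarrow> sat S ((x + 1) \<triangleright> v) \<phi>) \<longrightarrow>
       (\<forall>x. sat S (x \<triangleright> v) \<phi>))"

definition sigma_collection :: "nat \<Rightarrow> 'm::pa_minus set set \<Rightarrow> bool" where
  "sigma_collection n \<X> \<longleftrightarrow>
    (\<forall>\<phi> S v a. sigma_fm n \<phi> \<and> range S \<subseteq> \<X> \<and>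
       (\<forall>x<a. \<exists>y. sat S (x \<triangleright> y \<triangleright> v) \<phi>) \<longrightarrow>
       (\<exists>b. \<forall>x<a. \<exists>y<b. sat S (x \<triangleright> y \<triangleright> v) \<phi>))"

definition delta1_comprehension :: "'m::pa_minus set set \<Rightarrow> bool" where
  "delta1_comprehension \<X> \<longleftrightarrow>
    (\<forall>\<phi> \<psi> S v. sigma_fm 1 \<phi> \<and> pi_fm 1 \<psi> \<and> range S \<subseteq> \<X> \<and>
       (\<forall>x. sat S (x \<triangleright> v) \<phi> \<longleftrightarrow> sat S (x \<triangleright> v) \<psi>) \<longrightarrow>
       {x. sat S (x \<triangleright> v) \<phi>} \<in> \<X>)"

text \<open>
  \<open>\<X> \<noteq> {}\<close> is part of the notion of a structure for second-order arithmetic.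
\<close>

definition RCA0 :: "'m::pa_minus set set \<Rightarrow> bool" where
  "RCA0 \<X> \<longleftrightarrow> \<X> \<noteq> {} \<and> sigma_induction 1 \<X> \<and> delta1_comprehension \<X>"

text \<open>
  As usual, the theory \<open>B\<Sigma>\<^sup>0\<^sub>n\<close> is the collection scheme over the base theory \<open>PA\<^sup>-\<close> plus induction for
  bounded formulas.
\<close>

definition BSigma :: "nat \<Rightarrow> 'm::pa_minus set set \<Rightarrow> bool" where
  "BSigma n \<X> \<longleftrightarrow> sigma_induction 0 \<X> \<and> sigma_collection n \<X>"

definition BSigma2_model :: "'m::pa_minus set set \<Rightarrow> bool" where
  "BSigma2_model \<X> \<longleftrightarrow> RCA0 \<X> \<and> BSigma 2 \<X> \<and> \<not> sigma_induction 2 \<X>"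


section \<open>The Turing jump\<close>

text \<open>
  The enumeration of the partial \<open>\<Sigma>\<^sup>0\<^sub>1\<close>-functions with oracle \<open>A\<close> uses Shoenfield's generation of the
  partial recursive functions: from addition, multiplication, the characteristic function of \<open><\<close>
  and that of the oracle, by composition and minimization. Indices and computations are elements
  of \<open>M\<close>, possibly nonstandard; an inductive predicate of HOL would only admit computations of
  standard length.

  The pairing function is not onto, but it is injective in every model of \<open>PA\<^sup>-\<close>, since
  \<open>cpair x y\<close> lies between \<open>(x + y)\<^sup>2\<close> and \<open>(x + y + 1)\<^sup>2\<close>.
\<close>

definition cpair :: "'m::pa_minus \<Rightarrow> 'm \<Rightarrow> 'm" where
  "cpair x y = (x + y) * (x + y) + x"

text \<open>
  \<open>entry s i r\<close>: the \<open>i\<close>-th entry of the sequence coded by \<open>s\<close> is \<open>r\<close>, by Goedel's beta function.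
\<close>

definition entry :: "'m::pa_minus \<Rightarrow> 'm \<Rightarrow> 'm \<Rightarrow> bool" where
  "entry s i r \<longleftrightarrow>
    (\<exists>a b q. s = cpair a b \<and> a = q * (1 + (i + 1) * b) + r \<and> r < 1 + (i + 1) * b)"

text \<open>
  \<open>justified A D e x y\<close>: the value \<open>y\<close> of the function with index \<open>e\<close> at the argument \<open>x\<close> follows in
  one step from the values recorded in \<open>D\<close>. All functions are unary, with arguments paired where
  necessary. The disjuncts are, in order: constants, identity, the two projections, addition,
  multiplication, the characteristic functions of \<open><\<close> and of the oracle, pairing, composition
  (\<open>f\<close> after \<open>g\<close>), and minimization (the least \<open>y\<close> with \<open>f (x, y) = 0\<close>).
\<close>

definition justified ::
    "'m::pa_minus set \<Rightarrow> ('m \<Rightarrow> 'm \<Rightarrow> 'm \<Rightarrow> bool) \<Rightarrow> 'm \<Rightarrow> 'm \<Rightarrow> 'm \<Rightarrow> bool" where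
  "justified A D e x y \<longleftrightarrow>
      e = cpair 0 y
    \<or> e = cpair 1 0 \<and> y = x
    \<or> e = cpair 1 1 \<and> (\<exists>z. x = cpair y z)
    \<or> e = cpair 1 2 \<and> (\<exists>z. x = cpair z y)
    \<or> e = cpair 1 3 \<and> (\<exists>a b. x = cpair a b \<and> y = a + b)
    \<or> e = cpair 1 4 \<and> (\<exists>a b. x = cpair a b \<and> y = a * b)
    \<or> e = cpair 1 5 \<and> (\<exists>a b. x = cpair a b \<and> y = of_bool (a < b))
    \<or> e = cpair 1 6 \<and> y = of_bool (x \<in> A)
    \<or> (\<exists>f g a b. e = cpair 2 (cpair f g) \<and> D f x a \<and> D g x b \<and> y = cpair a b)
    \<or> (\<exists>f g z. e = cpair 3 (cpair f g) \<and> D g x z \<and> D f z y)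
    \<or> (\<exists>f. e = cpair 4 f \<and> D f (cpair x y) 0 \<and> (\<forall>z<y. \<exists>w. w \<noteq> 0 \<and> D f (cpair x z) w))"

definition recorded :: "'m::pa_minus \<Rightarrow> 'm \<Rightarrow> 'm \<Rightarrow> 'm \<Rightarrow> 'm \<Rightarrow> bool" where
  "recorded d i e x y \<longleftrightarrow> entry d i (cpair e (cpair x y))"

text \<open>
  A computation of length \<open>n\<close>: each of the first \<open>n\<close> entries of the sequence coded by \<open>d\<close> is
  justified by earlier entries.
\<close>

definition computation :: "'m::pa_minus set \<Rightarrow> 'm \<Rightarrow> 'm \<Rightarrow> bool" where
  "computation A d n \<longleftrightarrow>
    (\<forall>i<n. \<exists>e x y. recorded d i e x y \<and> justified A (\<lambda>e' x' y'. \<exists>j<i. recorded d j e' x' y') e x y)"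

text \<open>\<open>Phi A e x y\<close>: the \<open>e\<close>-th partial function with oracle \<open>A\<close> is defined at \<open>x\<close> with value \<open>y\<close>.\<close>

definition Phi :: "'m::pa_minus set \<Rightarrow> 'm \<Rightarrow> 'm \<Rightarrow> 'm \<Rightarrow> bool" where
  "Phi A e x y \<longleftrightarrow> (\<exists>d n. computation A d n \<and> (\<exists>i<n. recorded d i e x y))"

definition jump :: "'m::pa_minus set \<Rightarrow> 'm set" where
  "jump A = {e. \<exists>y. Phi A e e y}"

end

theory Submission
  imports Defs
begin

text \<open>
  Since \<open>\<Sigma>\<^sub>2\<close>-induction fails for \<open>A\<close>, there are a proper \<open>\<Sigma>\<^sub>2(A)\<close>-cut \<open>I\<close> and a cofinal
  map \<open>f\<close> from \<open>I\<close> to \<open>M\<close> whose graph is \<open>\<Delta>\<^sub>2(A)\<close>. Let \<open>X\<close> be \<open>\<Sigma>\<^sub>3(A)\<close>, say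
  \<open>x \<in> X \<longleftrightarrow> (\<exists>y. \<forall>z. \<theta> x y z)\<close> with \<open>\<theta>\<close> in \<open>\<Delta>\<^sub>2(A)\<close>, and let the type of \<open>x\<close> be the set of all
  \<open>(k, j)\<close> in \<open>I \<times> I\<close> with \<open>\<exists>y<f k. \<forall>z<f j. \<theta> x y z\<close>. By collection the type of \<open>x\<close> determines
  whether \<open>x \<in> X\<close>.

  Suppose moreover that \<open>X\<close> is \<open>\<Delta>\<^sub>2(A \<oplus> G)\<close>. By the coding lemma of Chong and Mourad (disjoint
  bounded \<open>\<Sigma>\<^sub>2\<close>-sets are separated by a coded set, which is just \<open>B\<Sigma>\<^sub>2\<close>) and overspill, for every
  \<open>i \<in> I\<close> there is an \<open>l \<in> I\<close> such that the types cut off at \<open>l\<close> already separate the elements of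
  \<open>X\<close> below \<open>f i\<close> from the other numbers below \<open>f i\<close>. By the coding lemma again, the set of all
  \<open>(i, l, t)\<close> such that \<open>t\<close> is the type cut off at \<open>l\<close> of some \<open>x < f i\<close> outside \<open>X\<close> is coded on
  \<open>I\<close>, and from this code \<open>X\<close> is \<open>\<Delta>\<^sub>2(A)\<close>.

  Applied to \<open>G\<close>, this shows that \<open>G\<close> is \<open>\<Delta>\<^sub>2(A)\<close>; so \<open>G'\<close>, being \<open>\<Sigma>\<^sub>1(G)\<close>, is
  \<open>\<Sigma>\<^sub>2(A)\<close>, and a second application shows that \<open>G'\<close> is \<open>\<Delta>\<^sub>2(A)\<close>, which is \<open>\<Delta>\<^sub>1(A')\<close>.
\<close>

section \<open>Definability with parameters\<close>

instance pa_minus \<subseteq> linordered_nonzero_semiring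
  by standard (simp_all add: zero_less_iff_neq_zero)

section \<open>Order and successor in a discretely ordered semiring\<close>

lemma less_succ: "(x::'m::pa_minus) < x + 1"
  using add_strict_left_mono[of 0 1 x] by (simp add: zero_less_iff_neq_zero)

lemma less_iff_succ_le: "(x::'m::pa_minus) < y \<longleftrightarrow> x + 1 \<le> y"
  by (metis less_succ add.right_neutral add_le_cancel_left add_less_cancel_left
      canonically_ordered_monoid_add_class.lessE discrete order_less_le_trans)

lemma less_succ_iff: "(x::'m::pa_minus) < y + 1 \<longleftrightarrow> x \<le> y"
  using less_iff_succ_le[of x "y + 1"] by simp

lemma exists_upper_two: "\<exists>b. (x::'m::pa_minus) < b \<and> y < b"
  using le_less_trans[OF max.cobounded1 less_succ] le_less_trans[OF max.cobounded2 less_succ]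
  by blast

section \<open>Substitution of terms and renaming of set variables\<close>

primrec subt :: "(nat \<Rightarrow> tm) \<Rightarrow> tm \<Rightarrow> tm" where
  "subt \<tau> (Var i) = \<tau> i"
| "subt \<tau> Zero = Zero"
| "subt \<tau> One = One"
| "subt \<tau> (Add s t) = Add (subt \<tau> s) (subt \<tau> t)"
| "subt \<tau> (Mul s t) = Mul (subt \<tau> s) (subt \<tau> t)"

definition lift_sub :: "(nat \<Rightarrow> tm) \<Rightarrow> nat \<Rightarrow> tm" where
  "lift_sub \<tau> i = (case i of 0 \<Rightarrow> Var 0 | Suc j \<Rightarrow> subt (\<lambda>n. Var (Suc n)) (\<tau> j))"

primrec sub :: "(nat \<Rightarrow> nat) \<Rightarrow> (nat \<Rightarrow> tm) \<Rightarrow> fm \<Rightarrow> fm" where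
  "sub h \<tau> (Eq s t) = Eq (subt \<tau> s) (subt \<tau> t)"
| "sub h \<tau> (Less s t) = Less (subt \<tau> s) (subt \<tau> t)"
| "sub h \<tau> (Mem t k) = Mem (subt \<tau> t) (h k)"
| "sub h \<tau> (Neg \<phi>) = Neg (sub h \<tau> \<phi>)"
| "sub h \<tau> (Conj \<phi> \<psi>) = Conj (sub h \<tau> \<phi>) (sub h \<tau> \<psi>)"
| "sub h \<tau> (Disj \<phi> \<psi>) = Disj (sub h \<tau> \<phi>) (sub h \<tau> \<psi>)"
| "sub h \<tau> (BForall t \<phi>) = BForall (subt \<tau> t) (sub h (lift_sub \<tau>) \<phi>)"
| "sub h \<tau> (BExists t \<phi>) = BExists (subt \<tau> t) (sub h (lift_sub \<tau>) \<phi>)"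
| "sub h \<tau> (Forall \<phi>) = Forall (sub h (lift_sub \<tau>) \<phi>)"
| "sub h \<tau> (Exists \<phi>) = Exists (sub h (lift_sub \<tau>) \<phi>)"

lemma scons_0 [simp]: "(a \<triangleright> v) 0 = a"
  and scons_Suc [simp]: "(a \<triangleright> v) (Suc i) = v i"
  by (simp_all add: scons_def)

lemma scons_1 [simp]: "(a \<triangleright> v) 1 = v 0"
  using scons_Suc[of a v 0] by simp

lemma scons_eta [simp]: "(v 0 \<triangleright> (\<lambda>i. v (Suc i))) = v"
  by (auto simp: scons_def fun_eq_iff split: nat.split)

lemma val_subt: "val v (subt \<tau> t) = val (\<lambda>i. val v (\<tau> i)) t"
  by (induction t) auto

lemma val_lift_sub: "(\<lambda>i. val (x \<triangleright> v) (lift_sub \<tau> i)) = x \<triangleright> (\<lambda>i. val v (\<tau> i))"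
  by (rule ext) (simp add: lift_sub_def val_subt scons_def split: nat.split)

lemma sat_sub: "sat S v (sub h \<tau> \<phi>) = sat (\<lambda>k. S (h k)) (\<lambda>i. val v (\<tau> i)) \<phi>"
  by (induction \<phi> arbitrary: v \<tau>) (auto simp: val_subt val_lift_sub)

lemma bounded_sub [simp]: "bounded_fm (sub h \<tau> \<phi>) = bounded_fm \<phi>"
  by (induction \<phi> arbitrary: \<tau>) auto

lemma sigma_pi_sub:
  shows "sigma_fm n \<phi> \<Longrightarrow> sigma_fm n (sub h \<tau> \<phi>)"
    and "pi_fm n \<phi> \<Longrightarrow> pi_fm n (sub h \<tau> \<phi>)"
  by (induction n \<phi> and n \<phi> arbitrary: \<tau> and \<tau> rule: sigma_fm_pi_fm.inducts)
     (auto intro: sigma_fm_pi_fm.intros)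

section \<open>Definable predicates of assignments\<close>

definition env :: "(nat \<Rightarrow> nat + 'm) \<Rightarrow> (nat \<Rightarrow> 'm) \<Rightarrow> nat \<Rightarrow> 'm" where
  "env E v i = (case E i of Inl j \<Rightarrow> v j | Inr c \<Rightarrow> c)"

text \<open>Two environments are interleaved so that two formulas with unrelated parameters can be
  read in a common one: the first uses the even variables, the second the odd ones.\<close>

definition mix :: "(nat \<Rightarrow> 'a) \<Rightarrow> (nat \<Rightarrow> 'a) \<Rightarrow> nat \<Rightarrow> 'a" where
  "mix E F i = (if even i then E (i div 2) else F (i div 2))"

lemma mix_simps [simp]: "mix E F (2 * i) = E i" "mix E F (Suc (2 * i)) = F i"
  by (simp_all add: mix_def)

lemma env_mix [simp]:
  "env (mix E F) v (2 * i) = env E v i" "env (mix E F) v (Suc (2 * i)) = env F v i"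
  by (simp_all add: env_def)

definition polyn :: "((nat \<Rightarrow> 'm::pa_minus) \<Rightarrow> 'm) \<Rightarrow> bool" where
  "polyn f \<longleftrightarrow> (\<exists>t E. \<forall>v. f v = val (env E v) t)"

text \<open>\<open>env E\<close> sends a variable either to a variable of \<open>v\<close>
  (\<open>Inl\<close>) or to a fixed number parameter (\<open>Inr\<close>). Definability is thus a
  property of HOL predicates on assignments, provable by introduction rules that follow the shape of
  the predicate; formulas appear only in the proofs of these rules.\<close>

definition dfn :: "(nat \<Rightarrow> 'm::pa_minus set) \<Rightarrow> (fm \<Rightarrow> bool) \<Rightarrow> ((nat \<Rightarrow> 'm) \<Rightarrow> bool) \<Rightarrow> bool" where
  "dfn S C P \<longleftrightarrow> (\<exists>\<phi> E. C \<phi> \<and> (\<forall>v. P v = sat S (env E v) \<phi>))"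

abbreviation "Bd S \<equiv> dfn S bounded_fm"
abbreviation "Sg S n \<equiv> dfn S (sigma_fm n)"
abbreviation "Pi S n \<equiv> dfn S (pi_fm n)"

lemma dfnI: "C \<phi> \<Longrightarrow> (\<And>v. P v = sat S (env E v) \<phi>) \<Longrightarrow> dfn S C P"
  unfolding dfn_def by blast

lemma dfn_sat: "C \<phi> \<Longrightarrow> dfn S C (\<lambda>v. sat S (env E v) \<phi>)"
  unfolding dfn_def by blast

lemma polyn_var: "polyn (\<lambda>v. v i)"
  unfolding polyn_def by (rule exI[of _ "Var 0"], rule exI[of _ "\<lambda>_. Inl i"]) (simp add: env_def)

lemma polyn_const: "polyn (\<lambda>v. c)"
  unfolding polyn_def by (rule exI[of _ "Var 0"], rule exI[of _ "\<lambda>_. Inr c"]) (simp add: env_def)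

lemma polyn_common:
  assumes "polyn f" "polyn g"
  obtains s t E where "\<And>v. f v = val (env E v) s" "\<And>v. g v = val (env E v) t"
proof -
  obtain s E t F where "\<And>v. f v = val (env E v) s" "\<And>v. g v = val (env F v) t"
    using assms unfolding polyn_def by blast
  then show ?thesis
    by (intro that[of "mix E F" "subt (\<lambda>i. Var (2 * i)) s" "subt (\<lambda>i. Var (Suc (2 * i))) t"])
       (auto simp: val_subt)
qed

lemma polyn_add: "polyn f \<Longrightarrow> polyn g \<Longrightarrow> polyn (\<lambda>v. f v + g v)"
  by (erule (1) polyn_common) (simp add: polyn_def, rule exI[where x = "Add _ _"], auto)

lemma polyn_mult: "polyn f \<Longrightarrow> polyn g \<Longrightarrow> polyn (\<lambda>v. f v * g v)"
  by (erule (1) polyn_common) (simp add: polyn_def, rule exI[where x = "Mul _ _"], auto)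

lemma Bd_eq: "polyn f \<Longrightarrow> polyn g \<Longrightarrow> Bd S (\<lambda>v. f v = g v)"
  by (erule (1) polyn_common, rule dfnI[where \<phi> = "Eq _ _"]) auto

lemma Bd_less: "polyn f \<Longrightarrow> polyn g \<Longrightarrow> Bd S (\<lambda>v. f v < g v)"
  by (erule (1) polyn_common, rule dfnI[where \<phi> = "Less _ _"]) auto

lemma Bd_mem: "polyn f \<Longrightarrow> Bd S (\<lambda>v. f v \<in> S k)"
  unfolding polyn_def by (clarify, rule dfnI[where \<phi> = "Mem _ k"]) auto

lemma Bd_neg: "Bd S P \<Longrightarrow> Bd S (\<lambda>v. \<not> P v)"
  unfolding dfn_def by (clarify, rename_tac \<phi> E, rule_tac x = "Neg \<phi>" in exI) auto

lemma dfn_common: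
  assumes P: "dfn S C P" and Q: "dfn S C' Q"
    and "\<And>h \<tau> \<phi>. C \<phi> \<Longrightarrow> C (sub h \<tau> \<phi>)" "\<And>h \<tau> \<phi>. C' \<phi> \<Longrightarrow> C' (sub h \<tau> \<phi>)"
  obtains \<phi> \<psi> E where "C \<phi>" "C' \<psi>" "\<And>v. P v = sat S (env E v) \<phi>" "\<And>v. Q v = sat S (env E v) \<psi>"
proof -
  obtain \<phi> E \<psi> F where
    "C \<phi>" "C' \<psi>" "\<And>v. P v = sat S (env E v) \<phi>" "\<And>v. Q v = sat S (env F v) \<psi>"
    using P Q unfolding dfn_def by blast
  then show ?thesis
    by (intro that[of "sub id (\<lambda>i. Var (2 * i)) \<phi>" "sub id (\<lambda>i. Var (Suc (2 * i))) \<psi>" "mix E F"])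
       (auto simp: sat_sub assms)
qed

lemma Bd_conj: "Bd S P \<Longrightarrow> Bd S Q \<Longrightarrow> Bd S (\<lambda>v. P v \<and> Q v)"
  by (erule (1) dfn_common) (simp_all flip: sat.simps, rule dfn_sat, simp)

lemma Bd_disj: "Bd S P \<Longrightarrow> Bd S Q \<Longrightarrow> Bd S (\<lambda>v. P v \<or> Q v)"
  by (erule (1) dfn_common) (simp_all flip: sat.simps, rule dfn_sat, simp)

lemma Bd_imp: "Bd S P \<Longrightarrow> Bd S Q \<Longrightarrow> Bd S (\<lambda>v. P v \<longrightarrow> Q v)"
  unfolding imp_conv_disj by (intro Bd_disj Bd_neg)

lemma Bd_le: "polyn f \<Longrightarrow> polyn g \<Longrightarrow> Bd S (\<lambda>v. f v \<le> g v)"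
  unfolding not_less[symmetric] by (intro Bd_neg Bd_less)

lemma Bd_iff: "Bd S P \<Longrightarrow> Bd S Q \<Longrightarrow> Bd S (\<lambda>v. P v = Q v)"
  unfolding iff_conv_conj_imp by (intro Bd_conj Bd_imp)

lemma Bd_const: "Bd S (\<lambda>v. b)"
  using Bd_eq[OF polyn_const[of 0] polyn_const[of "if b then 0 else 1"]] by (cases b) auto

text \<open>
  \<open>down E\<close> and \<open>Var \<circ> idx E\<close> move the variable \<open>0\<close>, which \<open>env E\<close> may put in many places,
  to the place of the variable bound by a quantifier.
\<close>

definition idx :: "(nat \<Rightarrow> nat + 'm) \<Rightarrow> nat \<Rightarrow> nat" where
  "idx E i = (if E i = Inl 0 then 0 else Suc i)"

definition down :: "(nat \<Rightarrow> nat + 'm::zero) \<Rightarrow> nat \<Rightarrow> nat + 'm" where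
  "down E i = (case E i of Inl j \<Rightarrow> (case j of 0 \<Rightarrow> Inr 0 | Suc k \<Rightarrow> Inl k) | Inr c \<Rightarrow> Inr c)"

lemma env_down: "(\<lambda>i. (x \<triangleright> env (down E) v) (idx E i)) = env E (x \<triangleright> v)"
  by (auto simp: env_def down_def idx_def fun_eq_iff split: sum.split nat.split)

text \<open>The pattern \<open>Q (v 0) (\<lambda>i. v (Suc i))\<close> makes the HOL-bound argument
  of \<open>Q\<close> variable 0. The quantifier rules use it as their premise, so that a HOL
  quantifier in a goal unifies with them.\<close>

lemma dfn_open:
  assumes "dfn S C (\<lambda>v. Q (v 0) (\<lambda>i. v (Suc i)))" "\<And>h \<tau> \<phi>. C \<phi> \<Longrightarrow> C (sub h \<tau> \<phi>)"
  obtains \<phi> E where "C \<phi>" "\<And>x v. Q x v = sat S (x \<triangleright> env E v) \<phi>"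
proof -
  obtain \<phi> E where 1: "C \<phi>" "\<And>v. Q (v 0) (\<lambda>i. v (Suc i)) = sat S (env E v) \<phi>"
    using assms(1) unfolding dfn_def by blast
  have "Q x v = sat S (x \<triangleright> env (down E) v) (sub id (\<lambda>i. Var (idx E i)) \<phi>)" for x v
    using 1(2)[of "x \<triangleright> v"] by (simp add: sat_sub env_down)
  then show ?thesis using that 1(1) assms(2) by blast
qed

lemma Bd_bquant:
  assumes f: "polyn f" and Q: "Bd S (\<lambda>v. Q (v 0) (\<lambda>i. v (Suc i)))"
  shows "Bd S (\<lambda>v. \<exists>x<f v. Q x v)" and "Bd S (\<lambda>v. \<forall>x<f v. Q x v)"
proof -
  obtain \<phi> E where \<phi>: "bounded_fm \<phi>" "\<And>x v. Q x v = sat S (x \<triangleright> env E v) \<phi>"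
    using dfn_open[OF Q] by auto
  obtain t F where t: "\<And>v. f v = val (env F v) t"
    using f unfolding polyn_def by blast
  let ?t = "subt (\<lambda>i. Var (Suc (2 * i))) t"
    and ?\<phi> = "sub id (lift_sub (\<lambda>i. Var (2 * i))) \<phi>"
  have "(\<exists>x<f v. Q x v) = sat S (env (mix E F) v) (BExists ?t ?\<phi>)"
    "(\<forall>x<f v. Q x v) = sat S (env (mix E F) v) (BForall ?t ?\<phi>)" for v
    by (simp_all add: sat_sub val_lift_sub val_subt \<phi> t)
  then show "Bd S (\<lambda>v. \<exists>x<f v. Q x v)" "Bd S (\<lambda>v. \<forall>x<f v. Q x v)"
    using \<phi>(1) by (auto simp only: bounded_fm.simps bounded_sub intro!: dfn_sat)
qed

lemmas polyn_intros = polyn_var polyn_const polyn_add polyn_mult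
lemmas Bd_intros = Bd_eq Bd_less Bd_le Bd_mem Bd_neg Bd_conj Bd_disj Bd_imp Bd_iff Bd_const Bd_bquant
  polyn_intros

lemma dfn_env:
  assumes "dfn S C P" shows "dfn S C (\<lambda>v. P (env F v))"
proof -
  obtain \<phi> E where 1: "C \<phi>" "\<And>v. P v = sat S (env E v) \<phi>"
    using assms unfolding dfn_def by blast
  have "env E (env F v) = env (\<lambda>i. case E i of Inl j \<Rightarrow> F j | Inr c \<Rightarrow> Inr c) v" for v
    by (auto simp: env_def fun_eq_iff split: sum.split)
  with 1 show ?thesis by (intro dfnI) auto
qed

lemma dfn_tail: "dfn S C P \<Longrightarrow> dfn S C (\<lambda>v. P (\<lambda>i. v (Suc i)))"
  using dfn_env[of S C P "\<lambda>i. Inl (Suc i)"] by (simp add: env_def[abs_def])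

lemma dfn_subst:
  assumes Q: "dfn S C (\<lambda>v. Q (v 0) (\<lambda>i. v (Suc i)))" and f: "polyn f"
    and C: "\<And>h \<tau> \<phi>. C \<phi> \<Longrightarrow> C (sub h \<tau> \<phi>)"
  shows "dfn S C (\<lambda>v. Q (f v) v)"
proof -
  obtain \<phi> E where \<phi>: "C \<phi>" "\<And>x v. Q x v = sat S (x \<triangleright> env E v) \<phi>"
    using dfn_open[OF Q] C by auto
  obtain t F where t: "\<And>v. f v = val (env F v) t"
    using f unfolding polyn_def by blast
  let ?\<tau> = "\<lambda>i. case i of 0 \<Rightarrow> subt (\<lambda>i. Var (Suc (2 * i))) t | Suc j \<Rightarrow> Var (2 * j)"
  have "(\<lambda>i. val (env (mix E F) v) (?\<tau> i)) = f v \<triangleright> env E v" for v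
    by (rule ext) (simp add: val_subt t scons_def split: nat.split)
  then have "Q (f v) v = sat S (env (mix E F) v) (sub id ?\<tau> \<phi>)" for v
    by (simp add: sat_sub \<phi>)
  then show ?thesis using \<phi>(1) C by (intro dfnI)
qed

text \<open>Renaming set variables transfers definability from a structure with fewer sets to one
  with more.\<close>

lemma dfn_set_subst:
  assumes "dfn S C P" "\<And>k. S k = S' (h k)" "\<And>h \<tau> \<phi>. C \<phi> \<Longrightarrow> C (sub h \<tau> \<phi>)"
  shows "dfn S' C P"
proof -
  obtain \<phi> E where 1: "C \<phi>" "\<And>v. P v = sat S (env E v) \<phi>"
    using assms(1) unfolding dfn_def by blast
  have "S = (\<lambda>k. S' (h k))" using assms(2) by auto
  then have "P v = sat S' (env E v) (sub h Var \<phi>)" for v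
    by (simp add: sat_sub 1)
  then show ?thesis using 1 assms(3) by (intro dfnI)
qed

section \<open>The levels of the arithmetical hierarchy\<close>

lemma sigma_fm_0: "sigma_fm 0 \<phi> = bounded_fm \<phi>" and pi_fm_0: "pi_fm 0 \<phi> = bounded_fm \<phi>"
  by (subst sigma_fm.simps pi_fm.simps, simp)+

lemma Sg_0: "Sg S 0 = Bd S" and Pi_0: "Pi S 0 = Bd S"
  by (simp_all add: fun_eq_iff dfn_def sigma_fm_0 pi_fm_0)

lemma dfn_mono: "dfn S C P \<Longrightarrow> (\<And>\<phi>. C \<phi> \<Longrightarrow> C' \<phi>) \<Longrightarrow> dfn S C' P"
  unfolding dfn_def by blast

lemma sigma_pi_Suc:
  shows "sigma_fm n \<phi> \<Longrightarrow> sigma_fm (Suc n) \<phi>" and "pi_fm n \<phi> \<Longrightarrow> pi_fm (Suc n) \<phi>"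
  by (induction n \<phi> and n \<phi> rule: sigma_fm_pi_fm.inducts) (auto intro: sigma_fm_pi_fm.intros)

lemma Sg_Suc: "Sg S n P \<Longrightarrow> Sg S (Suc n) P" and Pi_Suc: "Pi S n P \<Longrightarrow> Pi S (Suc n) P"
  and Pi_Sg: "Pi S n P \<Longrightarrow> Sg S (Suc n) P" and Sg_Pi: "Sg S n P \<Longrightarrow> Pi S (Suc n) P"
  by (auto elim!: dfn_mono intro: sigma_pi_Suc sigma_fm_pi_fm.intros)

text \<open>The classes admit \<open>Neg\<close> only inside the bounded matrix, so a negation is
  pushed through the prefix, which dualises it.\<close>

lemma sigma_pi_neg:
  shows "sigma_fm n \<phi> \<Longrightarrow> \<exists>\<psi>. pi_fm n \<psi> \<and> (\<forall>v. sat S v \<psi> = (\<not> sat S v \<phi>))"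
    and "pi_fm n \<phi> \<Longrightarrow> \<exists>\<psi>. sigma_fm n \<psi> \<and> (\<forall>v. sat S v \<psi> = (\<not> sat S v \<phi>))"
proof (induction n \<phi> and n \<phi> rule: sigma_fm_pi_fm.inducts)
  case (1 \<phi>) then show ?case by (intro exI[of _ "Neg \<phi>"]) (auto intro: sigma_fm_pi_fm.intros)
next
  case (2 \<phi>) then show ?case by (intro exI[of _ "Neg \<phi>"]) (auto intro: sigma_fm_pi_fm.intros)
next
  case (3 n \<phi>) then show ?case by (auto intro: sigma_fm_pi_fm.intros)
next
  case (4 n \<phi>) then show ?case by (auto intro: sigma_fm_pi_fm.intros)
next
  case (5 n \<phi>)
  then obtain \<psi> where "pi_fm (Suc n) \<psi>" "\<forall>v. sat S v \<psi> = (\<not> sat S v \<phi>)" by blast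
  then show ?case by (intro exI[of _ "Forall \<psi>"]) (auto intro: sigma_fm_pi_fm.intros)
next
  case (6 n \<phi>)
  then obtain \<psi> where "sigma_fm (Suc n) \<psi>" "\<forall>v. sat S v \<psi> = (\<not> sat S v \<phi>)" by blast
  then show ?case by (intro exI[of _ "Exists \<psi>"]) (auto intro: sigma_fm_pi_fm.intros)
qed

lemma Sg_neg: "Sg S n P \<Longrightarrow> Pi S n (\<lambda>v. \<not> P v)" and Pi_neg: "Pi S n P \<Longrightarrow> Sg S n (\<lambda>v. \<not> P v)"
  unfolding dfn_def by (blast dest: sigma_pi_neg[where S = S])+

lemma Sg_ex: "Sg S (Suc n) (\<lambda>v. Q (v 0) (\<lambda>i. v (Suc i))) \<Longrightarrow> Sg S (Suc n) (\<lambda>v. \<exists>x. Q x v)"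
  by (erule dfn_open, erule sigma_pi_sub) (simp flip: sat.simps, rule dfn_sat, erule sigma_fm_pi_fm.intros)

lemma Bd_Sg: "Bd S P \<Longrightarrow> Sg S n P" and Bd_Pi: "Bd S P \<Longrightarrow> Pi S n P"
proof -
  assume "Bd S P"
  then have "Sg S n P \<and> Pi S n P"
    by (induction n) (auto simp: Sg_0 Pi_0 intro: Sg_Suc Pi_Suc)
  then show "Sg S n P" "Pi S n P" by auto
qed

lemma sigma_fm_Suc_iff:
  "sigma_fm (Suc n) \<phi> \<longleftrightarrow> pi_fm n \<phi> \<or> (\<exists>\<psi>. \<phi> = Exists \<psi> \<and> sigma_fm (Suc n) \<psi>)"
  by (subst sigma_fm.simps) auto

text \<open>The mutual induction rule lets the level vary; structural induction on the formula keeps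
  it fixed and treats the whole \<Pi> part as the base case.\<close>

lemma sigma_fm_Suc_induct:
  assumes "sigma_fm (Suc n) \<phi>" "\<And>\<phi>. pi_fm n \<phi> \<Longrightarrow> K \<phi>"
    "\<And>\<phi>. sigma_fm (Suc n) \<phi> \<Longrightarrow> K \<phi> \<Longrightarrow> K (Exists \<phi>)"
  shows "K \<phi>"
  using assms(1)
proof (induction \<phi> rule: fm.induct)
  case (Exists \<phi>)
  from sigma_fm_Suc_iff[THEN iffD1, OF Exists.prems] show ?case
    using Exists.IH assms(2,3) by auto
qed (drule sigma_fm_Suc_iff[THEN iffD1], auto intro: assms(2))+

text \<open>Stated for \<Sigma> only, since the \<Pi> half follows by negation. At level 0 it holds
  outright; higher levels are reached through collection.\<close>

definition clos :: "(nat \<Rightarrow> 'm::pa_minus set) \<Rightarrow> nat \<Rightarrow> bool" where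
  "clos S n \<longleftrightarrow>
    (\<forall>P Q. Sg S n P \<longrightarrow> Sg S n Q \<longrightarrow> Sg S n (\<lambda>v. P v \<and> Q v) \<and> Sg S n (\<lambda>v. P v \<or> Q v)) \<and>
    (\<forall>f Q. polyn f \<longrightarrow> Sg S n (\<lambda>v. Q (v 0) (\<lambda>i. v (Suc i))) \<longrightarrow>
       Sg S n (\<lambda>v. \<exists>x<f v. Q x v) \<and> Sg S n (\<lambda>v. \<forall>x<f v. Q x v))"

lemma clos_0: "clos S 0"
  unfolding clos_def Sg_0 by (auto intro: Bd_intros)

lemma clos_Sg:
  assumes "clos S n"
  shows Sg_conj: "Sg S n P \<Longrightarrow> Sg S n Q \<Longrightarrow> Sg S n (\<lambda>v. P v \<and> Q v)"
    and Sg_disj: "Sg S n P \<Longrightarrow> Sg S n Q \<Longrightarrow> Sg S n (\<lambda>v. P v \<or> Q v)"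
    and Sg_bex: "polyn f \<Longrightarrow> Sg S n (\<lambda>v. R (v 0) (\<lambda>i. v (Suc i))) \<Longrightarrow> Sg S n (\<lambda>v. \<exists>x<f v. R x v)"
    and Sg_ball: "polyn f \<Longrightarrow> Sg S n (\<lambda>v. R (v 0) (\<lambda>i. v (Suc i))) \<Longrightarrow> Sg S n (\<lambda>v. \<forall>x<f v. R x v)"
  using assms unfolding clos_def by blast+

lemma Pi_iff_Sg: "Pi S n P \<longleftrightarrow> Sg S n (\<lambda>v. \<not> P v)"
  using Sg_neg[of S n "\<lambda>v. \<not> P v"] Pi_neg[of S n P] by auto

lemma clos_Pi:
  assumes "clos S n"
  shows Pi_conj: "Pi S n P \<Longrightarrow> Pi S n Q \<Longrightarrow> Pi S n (\<lambda>v. P v \<and> Q v)"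
    and Pi_disj: "Pi S n P \<Longrightarrow> Pi S n Q \<Longrightarrow> Pi S n (\<lambda>v. P v \<or> Q v)"
    and Pi_bex: "polyn f \<Longrightarrow> Pi S n (\<lambda>v. R (v 0) (\<lambda>i. v (Suc i))) \<Longrightarrow> Pi S n (\<lambda>v. \<exists>x<f v. R x v)"
    and Pi_ball: "polyn f \<Longrightarrow> Pi S n (\<lambda>v. R (v 0) (\<lambda>i. v (Suc i))) \<Longrightarrow> Pi S n (\<lambda>v. \<forall>x<f v. R x v)"
  using clos_Sg(1,2)[OF assms, of "\<lambda>v. \<not> P v" "\<lambda>v. \<not> Q v"]
    clos_Sg(3,4)[OF assms, of f "\<lambda>x v. \<not> R x v"]
  unfolding Pi_iff_Sg by simp_all

lemma bounded_ex_two: "(\<exists>x y. R x y) \<longleftrightarrow> (\<exists>b::'m::pa_minus. \<exists>x<b. \<exists>y<b. R x y)"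
  using exists_upper_two by metis

text \<open>Two existential quantifiers become one by quantifying a common bound instead of a coded
  pair; the witnesses are then bounded, and bounded quantifiers keep the matrix \<Pi>.\<close>

lemma Sg_Suc_contract:
  assumes "clos S n" "Sg S (Suc n) P"
  obtains R where "Pi S n (\<lambda>v. R (v 0) (\<lambda>i. v (Suc i)))" "\<And>v. P v \<longleftrightarrow> (\<exists>y. R y v)"
proof -
  obtain \<phi> E where P: "sigma_fm (Suc n) \<phi>" "\<And>v. P v = sat S (env E v) \<phi>"
    using assms(2) unfolding dfn_def by blast
  from P(1) have "\<exists>R. Pi S n (\<lambda>v. R (v 0) (\<lambda>i. v (Suc i))) \<and> (\<forall>v. sat S v \<phi> = (\<exists>y. R y v))"
  proof (rule sigma_fm_Suc_induct, goal_cases)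
    case (1 \<phi>)
    have "Pi S n (\<lambda>v. sat S v \<phi>)"
      using 1 dfn_sat[of "pi_fm n" \<phi> S Inl] by (simp add: env_def[abs_def])
    from dfn_tail[OF this] show ?case
      by (intro exI[of _ "\<lambda>y v. sat S v \<phi>"]) simp
  next
    case (2 \<phi>)
    then obtain R where R: "Pi S n (\<lambda>v. R (v 0) (\<lambda>i. v (Suc i)))" "\<And>v. sat S v \<phi> = (\<exists>y. R y v)"
      by blast
    let ?R = "\<lambda>b v. \<exists>x<b. \<exists>y<b. R y (x \<triangleright> v)"
    \<comment> \<open>Index 0 is \<open>y\<close> and index 1 is \<open>x\<close>; index 2 is the
      new bound \<open>b\<close>, which is skipped.\<close>
    let ?F = "\<lambda>i. Inl (case i of 0 \<Rightarrow> 0 | Suc i \<Rightarrow> (case i of 0 \<Rightarrow> 1 | Suc i \<Rightarrow> Suc (Suc (Suc i)))) :: nat + 'a"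
    have "env ?F v 0 = v 0" "(\<lambda>i. env ?F v (Suc i)) = v 1 \<triangleright> (\<lambda>i. v (Suc (Suc (Suc i))))" for v
      by (auto simp: env_def fun_eq_iff scons_def split: nat.split)
    then have "Pi S n (\<lambda>v. R (v 0) (v 1 \<triangleright> (\<lambda>i. v (Suc (Suc (Suc i))))))"
      using dfn_env[OF R(1), of ?F] by simp
    then have "Pi S n (\<lambda>v. ?R (v 0) (\<lambda>i. v (Suc i)))"
      by (intro Pi_bex[OF assms(1)] polyn_intros) simp
    moreover have "sat S v (Exists \<phi>) = (\<exists>b. ?R b v)" for v
      using bounded_ex_two[of "\<lambda>x y. R y (x \<triangleright> v)"] by (simp add: R(2))
    ultimately show ?case by (intro exI[of _ ?R]) auto
  qed
  then obtain R where R: "Pi S n (\<lambda>v. R (v 0) (\<lambda>i. v (Suc i)))" "\<And>v. sat S v \<phi> = (\<exists>y. R y v)"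
    by blast
  let ?F = "\<lambda>i. case i of 0 \<Rightarrow> Inl 0 | Suc i \<Rightarrow> (case E i of Inl j \<Rightarrow> Inl (Suc j) | Inr c \<Rightarrow> Inr c)"
  have "env ?F v 0 = v 0" "(\<lambda>i. env ?F v (Suc i)) = env E (\<lambda>i. v (Suc i))" for v
    by (auto simp: env_def fun_eq_iff split: nat.split sum.split)
  then have "Pi S n (\<lambda>v. R (v 0) (env E (\<lambda>i. v (Suc i))))"
    using dfn_env[OF R(1), of ?F] by simp
  then show ?thesis using that[of "\<lambda>y v. R y (env E v)"] P(2) R(2) by simp
qed

section \<open>Closure properties and induction under collection\<close>

definition coll :: "(nat \<Rightarrow> 'm::pa_minus set) \<Rightarrow> nat \<Rightarrow> bool" where
  "coll S n \<longleftrightarrow> (\<forall>\<phi> v a. sigma_fm n \<phi> \<longrightarrow> (\<forall>x<a. \<exists>y. sat S (x \<triangleright> y \<triangleright> v) \<phi>) \<longrightarrow>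
     (\<exists>b. \<forall>x<a. \<exists>y<b. sat S (x \<triangleright> y \<triangleright> v) \<phi>))"

lemma collD:
  assumes "coll S n" "Sg S n (\<lambda>v. R (v 0) (v 1))" "\<And>x. x < a \<Longrightarrow> \<exists>y. R x y"
  shows "\<exists>b. \<forall>x<a. \<exists>y<b. R x y"
proof -
  obtain \<phi> E where \<phi>: "sigma_fm n \<phi>" "\<And>v. R (v 0) (v 1) = sat S (env E v) \<phi>"
    using assms(2) unfolding dfn_def by blast
  \<comment> \<open>\<open>E\<close> may put the variables 0 and 1 in many places; \<open>r\<close>
    collects them at 0 and 1 and moves everything else up by two. The other variables do not affect
    \<open>R\<close>, so \<open>?w\<close> sets them to 0.\<close>
  define r where "r i = (if E i = Inl 0 then 0 else if E i = Inl 1 then 1 else Suc (Suc i))" for i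
  let ?w = "env E (\<lambda>_. 0)"
  have "R x y = sat S (x \<triangleright> y \<triangleright> ?w) (sub id (\<lambda>i. Var (r i)) \<phi>)" for x y
  proof -
    have "(\<lambda>i. (x \<triangleright> y \<triangleright> ?w) (r i)) = env E (x \<triangleright> y \<triangleright> (\<lambda>_. 0))"
      by (auto simp: env_def r_def fun_eq_iff scons_def split: sum.split nat.split)
    then show ?thesis using \<phi>(2)[of "x \<triangleright> y \<triangleright> (\<lambda>_. 0)"] by (simp add: sat_sub)
  qed
  moreover have "sigma_fm n (sub id (\<lambda>i. Var (r i)) \<phi>)" using \<phi>(1) by (rule sigma_pi_sub)
  ultimately show ?thesis
    using assms(1,3) unfolding coll_def by (simp only:) blast
qed

lemma polyn_tail: "polyn f \<Longrightarrow> polyn (\<lambda>v. f (\<lambda>i. v (Suc i)))"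
proof -
  assume "polyn f"
  then obtain t E where "\<And>v. f v = val (env E v) t" unfolding polyn_def by blast
  then have "f (\<lambda>i. v (Suc i)) = val (env (\<lambda>i. map_sum Suc id (E i)) v) t" for v
    by (auto simp: env_def intro!: arg_cong[where f = "\<lambda>v. val v t"] split: sum.split)
  then show ?thesis unfolding polyn_def by blast
qed

lemma Sg_mono: "Sg S m P \<Longrightarrow> m \<le> n \<Longrightarrow> Sg S n P"
  by (rule dec_induct[of m n "\<lambda>n. Sg S n P"]) (auto intro: Sg_Suc)

lemma dfn_skip:
  assumes "dfn S C (\<lambda>v. R (v 0) (\<lambda>i. v (Suc i)))"
  shows "dfn S C (\<lambda>v. R (v 0) (\<lambda>i. v (Suc (Suc i))))"
    and "dfn S C (\<lambda>v. R (v 1) (\<lambda>i. v (Suc (Suc i))))"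
    and "dfn S C (\<lambda>v. R (v 0) (v 1 \<triangleright> (\<lambda>i. v (Suc (Suc (Suc i))))))"
proof -
  show "dfn S C (\<lambda>v. R (v 0) (\<lambda>i. v (Suc (Suc i))))"
    using dfn_env[OF assms, of "\<lambda>i. Inl (case i of 0 \<Rightarrow> 0 | Suc i \<Rightarrow> Suc (Suc i))"]
    by (simp add: env_def)
  show "dfn S C (\<lambda>v. R (v 1) (\<lambda>i. v (Suc (Suc i))))"
    using dfn_env[OF assms, of "\<lambda>i. Inl (Suc i)"] by (simp add: env_def)
  let ?F = "\<lambda>i. Inl (case i of 0 \<Rightarrow> 0 | Suc i \<Rightarrow> (case i of 0 \<Rightarrow> 1 | Suc i \<Rightarrow> Suc (Suc (Suc i)))) :: nat + 'a"
  have "env ?F v 0 = v 0" "(\<lambda>i. env ?F v (Suc i)) = v 1 \<triangleright> (\<lambda>i. v (Suc (Suc (Suc i))))" for v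
    by (auto simp: env_def fun_eq_iff scons_def split: nat.split)
  then show "dfn S C (\<lambda>v. R (v 0) (v 1 \<triangleright> (\<lambda>i. v (Suc (Suc (Suc i))))))"
    using dfn_env[OF assms, of ?F] by simp
qed

lemma dfn_close:
  assumes "dfn S C (\<lambda>v. R (v 0) (\<lambda>i. v (Suc i)))"
  shows "dfn S C (\<lambda>v. R (v 0) (v 1 \<triangleright> w))"
proof -
  let ?F = "\<lambda>i. case i of 0 \<Rightarrow> Inl 0 | Suc i \<Rightarrow> (case i of 0 \<Rightarrow> Inl 1 | Suc i \<Rightarrow> Inr (w i))"
  have "env ?F u 0 = u 0" "(\<lambda>i. env ?F u (Suc i)) = u 1 \<triangleright> w" for u
    by (auto simp: env_def fun_eq_iff scons_def split: nat.split)
  then show ?thesis using dfn_env[OF assms, of ?F] by simp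
qed

lemma dfn_swap: "dfn S C (\<lambda>v. R (v 0) (v 1)) \<Longrightarrow> dfn S C (\<lambda>v. R (v 1) (v 0))"
  using dfn_env[of S C "\<lambda>v. R (v 0) (v 1)" "\<lambda>i. Inl (if i = 0 then 1 else 0)"] by (simp add: env_def)

lemma Sg_Suc_contract_binary:
  assumes "clos S n" "Sg S (Suc n) (\<lambda>v. P (v 0))"
  obtains R where "Pi S n (\<lambda>v. R (v 0) (v 1))" "\<And>x. P x \<longleftrightarrow> (\<exists>y. R y x)"
proof -
  obtain R where R: "Pi S n (\<lambda>v. R (v 0) (\<lambda>i. v (Suc i)))" "\<And>v. P (v 0) \<longleftrightarrow> (\<exists>y. R y v)"
    using Sg_Suc_contract[OF assms] by blast
  show ?thesis
    using that[of "\<lambda>y x. R y (x \<triangleright> (\<lambda>_. 0))"] dfn_close[OF R(1)] R(2)[of "x \<triangleright> (\<lambda>_. 0)" for x]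
    by simp
qed

lemma nonzero_Suc: "(z::'m::pa_minus) \<noteq> 0 \<Longrightarrow> \<exists>y. z = y + 1"
  by (metis add.commute discrete le_iff_add zero_less_iff_neq_zero)

text \<open>Collection enters for the bounded universal quantifier: it bounds the witnesses for all
  \<open>x<f v\<close> at once and so moves the existential quantifier to the front.\<close>

lemma clos_Suc:
  assumes cl: "clos S n" and co: "coll S N" and le: "Suc n \<le> N"
  shows "clos S (Suc n)"
proof -
  have conj: "Sg S (Suc n) (\<lambda>v. P v \<and> Q v)" and disj: "Sg S (Suc n) (\<lambda>v. P v \<or> Q v)"
    if PQ: "Sg S (Suc n) P" "Sg S (Suc n) Q" for P Q
  proof -
    obtain R where R: "Pi S n (\<lambda>v. R (v 0) (\<lambda>i. v (Suc i)))" "\<And>v. P v \<longleftrightarrow> (\<exists>y. R y v)"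
      using Sg_Suc_contract[OF cl PQ(1)] by blast
    obtain T where T: "Pi S n (\<lambda>v. T (v 0) (\<lambda>i. v (Suc i)))" "\<And>v. Q v \<longleftrightarrow> (\<exists>y. T y v)"
      using Sg_Suc_contract[OF cl PQ(2)] by blast
    have "Sg S (Suc n) (\<lambda>v. \<exists>y z. R y v \<and> T z v)"
      by (intro Sg_ex Pi_Sg Pi_conj[OF cl] dfn_skip(1)[OF T(1)] dfn_skip(2)[OF R(1), unfolded One_nat_def])
    then show "Sg S (Suc n) (\<lambda>v. P v \<and> Q v)"
      by (simp add: R(2) T(2))
    have "Sg S (Suc n) (\<lambda>v. \<exists>y. R y v \<or> T y v)"
      by (intro Sg_ex Pi_Sg Pi_disj[OF cl] R T)
    then show "Sg S (Suc n) (\<lambda>v. P v \<or> Q v)"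
      by (simp add: R(2) T(2) ex_disj_distrib)
  qed
  have bex: "Sg S (Suc n) (\<lambda>v. \<exists>x<f v. Q x v)" and ball: "Sg S (Suc n) (\<lambda>v. \<forall>x<f v. Q x v)"
    if f: "polyn f" and Q: "Sg S (Suc n) (\<lambda>v. Q (v 0) (\<lambda>i. v (Suc i)))" for f Q
  proof -
    show "Sg S (Suc n) (\<lambda>v. \<exists>x<f v. Q x v)"
      by (intro Sg_ex conj Q Bd_Sg Bd_less polyn_var polyn_tail f)
    obtain R where R: "Pi S n (\<lambda>v. R (v 0) (\<lambda>i. v (Suc i)))"
        "\<And>v. Q (v 0) (\<lambda>i. v (Suc i)) \<longleftrightarrow> (\<exists>y. R y v)"
      using Sg_Suc_contract[OF cl Q] by blast
    have Q': "Q x v \<longleftrightarrow> (\<exists>y. R y (x \<triangleright> v))" for x v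
      using R(2)[of "x \<triangleright> v"] by simp
    have "(\<forall>x<f v. Q x v) \<longleftrightarrow> (\<exists>b. \<forall>x<f v. \<exists>y<b. R y (x \<triangleright> v))" for v
    proof
      assume *: "\<forall>x<f v. Q x v"
      let ?F = "\<lambda>i. case i of 0 \<Rightarrow> Inl 1 | Suc i \<Rightarrow> (case i of 0 \<Rightarrow> Inl 0 | Suc i \<Rightarrow> Inr (v i))"
      have "env ?F u 0 = u 1" "(\<lambda>i. env ?F u (Suc i)) = u 0 \<triangleright> v" for u
        by (auto simp: env_def fun_eq_iff scons_def split: nat.split)
      then have "Pi S n (\<lambda>u. R (u 1) (u 0 \<triangleright> v))"
        using dfn_env[OF R(1), of ?F] by simp
      then have "Sg S N (\<lambda>u. R (u 1) (u 0 \<triangleright> v))"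
        using Pi_Sg Sg_mono[OF _ le] by blast
      from collD[OF co this, of "f v"] * show "\<exists>b. \<forall>x<f v. \<exists>y<b. R y (x \<triangleright> v)"
        by (simp add: Q')
    qed (auto simp: Q')
    moreover have "Sg S (Suc n) (\<lambda>v. \<exists>b. \<forall>x<f v. \<exists>y<b. R y (x \<triangleright> v))"
      by (intro Sg_ex Pi_Sg Pi_ball[OF cl] Pi_bex[OF cl] polyn_var polyn_tail f
          dfn_skip(3)[OF R(1), unfolded One_nat_def])
    ultimately show "Sg S (Suc n) (\<lambda>v. \<forall>x<f v. Q x v)" by simp
  qed
  show ?thesis unfolding clos_def using conj disj bex ball by blast
qed

section \<open>\<open>\<Delta>\<^sub>2\<close> predicates and the induction available for
  them\<close>

definition D2 :: "(nat \<Rightarrow> 'm::pa_minus set) \<Rightarrow> ((nat \<Rightarrow> 'm) \<Rightarrow> bool) \<Rightarrow> bool" where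
  "D2 S P \<longleftrightarrow> Sg S 2 P \<and> Pi S 2 P"

lemma D2_Sg: "D2 S P \<Longrightarrow> Sg S 2 P"
  by (simp add: D2_def)

lemma D2_Sg1: "Sg S 1 P \<Longrightarrow> D2 S P" and D2_Pi1: "Pi S 1 P \<Longrightarrow> D2 S P"
  unfolding D2_def using Sg_Suc[of S 1] Sg_Pi[of S 1] Pi_Suc[of S 1] Pi_Sg[of S 1]
  by (auto simp: numeral_2_eq_2)

lemma D2_Bd: "Bd S P \<Longrightarrow> D2 S P"
  unfolding D2_def by (auto intro: Bd_Sg Bd_Pi)

lemma D2_neg: "D2 S P \<Longrightarrow> D2 S (\<lambda>v. \<not> P v)"
  unfolding D2_def by (auto intro: Sg_neg Pi_neg)

lemma D2_subst:
  "D2 S (\<lambda>v. Q (v 0) (\<lambda>i. v (Suc i))) \<Longrightarrow> polyn f \<Longrightarrow> D2 S (\<lambda>v. Q (f v) v)"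
  unfolding D2_def by (auto intro: dfn_subst sigma_pi_sub)

text \<open>The instances of \<open>BSigma 2\<close> that concern one fixed assignment
  \<open>S\<close> of sets. The locale is used with \<open>A\<close> alone and with \<open>A\<close>
  and \<open>G\<close> together.\<close>

locale bs2 =
  fixes S :: "nat \<Rightarrow> 'm::pa_minus set"
  assumes ind0: "bounded_fm \<phi> \<Longrightarrow> sat S (0 \<triangleright> w) \<phi> \<Longrightarrow>
      (\<And>x. sat S (x \<triangleright> w) \<phi> \<Longrightarrow> sat S ((x + 1) \<triangleright> w) \<phi>) \<Longrightarrow> sat S (x \<triangleright> w) \<phi>"
    and coll2: "coll S 2"
begin

lemma clos1: "clos S 1" and clos2: "clos S 2"
proof -
  show "clos S 1" using clos_Suc[OF clos_0 coll2] by simp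
  from clos_Suc[OF this coll2] show "clos S 2" by (simp add: numeral_2_eq_2)
qed

lemma D2_conj: "D2 S P \<Longrightarrow> D2 S Q \<Longrightarrow> D2 S (\<lambda>v. P v \<and> Q v)"
  and D2_disj: "D2 S P \<Longrightarrow> D2 S Q \<Longrightarrow> D2 S (\<lambda>v. P v \<or> Q v)"
  and D2_bex: "polyn f \<Longrightarrow> D2 S (\<lambda>v. R (v 0) (\<lambda>i. v (Suc i))) \<Longrightarrow> D2 S (\<lambda>v. \<exists>x<f v. R x v)"
  and D2_ball: "polyn f \<Longrightarrow> D2 S (\<lambda>v. R (v 0) (\<lambda>i. v (Suc i))) \<Longrightarrow> D2 S (\<lambda>v. \<forall>x<f v. R x v)"
  unfolding D2_def using clos_Sg[OF clos2] clos_Pi[OF clos2] by simp_all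

lemma D2_imp: "D2 S P \<Longrightarrow> D2 S Q \<Longrightarrow> D2 S (\<lambda>v. P v \<longrightarrow> Q v)"
  unfolding imp_conv_disj by (intro D2_disj D2_neg)

lemma D2_iff: "D2 S P \<Longrightarrow> D2 S Q \<Longrightarrow> D2 S (\<lambda>v. P v = Q v)"
  unfolding iff_conv_conj_imp by (intro D2_conj D2_imp)

lemmas D2_intros = D2_neg D2_conj D2_disj D2_imp D2_iff D2_bex D2_ball D2_Bd[OF Bd_eq]
  D2_Bd[OF Bd_less] D2_Bd[OF Bd_le] D2_Bd[OF Bd_mem] D2_Bd[OF Bd_const] polyn_intros

lemma Sg2_ex: "Sg S 2 (\<lambda>v. Q (v 0) (\<lambda>i. v (Suc i))) \<Longrightarrow> Sg S 2 (\<lambda>v. \<exists>x. Q x v)"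
  using Sg_ex[of S 1] by (simp add: numeral_2_eq_2)

lemmas Sg2_disj = Sg_disj[OF clos2]

lemma ind_Bd:
  assumes "Bd S (\<lambda>v. P (v 0))" "P 0" "\<And>x. P x \<Longrightarrow> P (x + 1)"
  shows "P x"
proof -
  obtain \<phi> E where \<phi>: "bounded_fm \<phi>" "\<And>x v. P x = sat S (x \<triangleright> env E v) \<phi>"
    using dfn_open[of S bounded_fm "\<lambda>x v. P x"] assms(1) by auto
  show ?thesis
    using ind0[OF \<phi>(1), of "env E (\<lambda>_. 0)"] assms(2,3) by (simp add: \<phi>(2)[of _ "\<lambda>_. 0"])
qed

lemma collection:
  assumes "Sg S 2 (\<lambda>v. R (v 0) (v 1))" "\<And>x. x < a \<Longrightarrow> \<exists>y. R x y"
  shows "\<exists>b. \<forall>x<a. \<exists>y<b. R x y"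
  using collD[OF coll2 assms] .

text \<open>Collection bounds the witnesses of \<open>P\<close> up to \<open>c\<close> by a single
  \<open>b\<close>. Up to \<open>c\<close>, \<open>P\<close> is then a bounded predicate, and
  bounded induction applies.\<close>

lemma ind_Sg1:
  assumes P: "Sg S 1 (\<lambda>v. P (v 0))" and 0: "P 0" and Suc: "\<And>x. P x \<Longrightarrow> P (x + 1)"
  shows "P c"
proof -
  obtain R' where R': "Bd S (\<lambda>v. R' (v 0) (v 1))" and P': "\<And>x. P x \<longleftrightarrow> (\<exists>y. R' y x)"
    using Sg_Suc_contract_binary[OF clos_0, of S P] P by (auto simp: Pi_0)
  note R1 = dfn_swap[OF R']
  have R2: "Pi S 1 (\<lambda>v. \<not> P (v 0))"
    using Sg_neg[OF P] .
  \<comment> \<open>The second disjunct makes the relation total, as collection requires; it raises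
    the complexity to \<Sigma>2.\<close>
  have "Sg S 2 (\<lambda>v. R' (v 1) (v 0) \<or> \<not> P (v 0))"
    by (intro Sg2_disj Bd_Sg R1 D2_Sg D2_Pi1 R2)
  then have "\<exists>b. \<forall>x<c+1. \<exists>y<b. R' y x \<or> \<not> P x"
    by (rule collection) (auto simp: P')
  then obtain b where b: "\<And>x. x < c + 1 \<Longrightarrow> P x \<longleftrightarrow> (\<exists>y<b. R' y x)"
    using P' by blast
  have "c \<le> c \<longrightarrow> (\<exists>y<b. R' y c)"
  proof (rule ind_Bd[where P = "\<lambda>x. x \<le> c \<longrightarrow> (\<exists>y<b. R' y x)"])
    show "Bd S (\<lambda>v. v 0 \<le> c \<longrightarrow> (\<exists>y<b. R' y (v 0)))"
      using R' by (intro Bd_intros) (simp_all add: One_nat_def)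
  next
    show "0 \<le> c \<longrightarrow> (\<exists>y<b. R' y 0)"
      using b[of 0] 0 by (simp add: less_succ_iff)
  next
    fix x assume *: "x \<le> c \<longrightarrow> (\<exists>y<b. R' y x)"
    show "x + 1 \<le> c \<longrightarrow> (\<exists>y<b. R' y (x + 1))"
    proof
      assume "x + 1 \<le> c"
      then have le: "x < c + 1" "x \<le> c" "x + 1 < c + 1"
        by (simp_all add: less_succ_iff order_less_imp_le flip: less_iff_succ_le)
      then show "\<exists>y<b. R' y (x + 1)"
        using * b[OF le(1)] b[OF le(3)] Suc[of x] by blast
    qed
  qed
  then show "P c" using b[OF less_succ] by simp
qed

text \<open>If \<open>P c\<close> fails, the failure is carried downwards: the set of
  \<open>x\<close> such that \<open>P\<close> fails at \<open>c - x\<close>, written without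
  subtraction, is \<Sigma>1 and inductive, yet cannot contain \<open>c + 1\<close>.\<close>

lemma ind_Pi1:
  assumes P: "Pi S 1 (\<lambda>v. P (v 0))" and 0: "P 0" and Suc: "\<And>x. P x \<Longrightarrow> P (x + 1)"
  shows "P c"
proof (rule ccontr)
  assume c: "\<not> P c"
  have N: "Sg S 1 (\<lambda>v. \<not> P (v 0))"
    using Pi_neg[OF P] .
  have "\<exists>z. z + (c + 1) = c \<and> \<not> P z"
  proof (rule ind_Sg1[where P = "\<lambda>x. \<exists>z. z + x = c \<and> \<not> P z"])
    show "Sg S 1 (\<lambda>v. \<exists>z. z + v 0 = c \<and> \<not> P z)"
      unfolding One_nat_def by (intro Sg_ex Sg_conj[OF clos1[unfolded One_nat_def]] Bd_Sg Bd_intros N[unfolded One_nat_def])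
  next
    show "\<exists>z. z + 0 = c \<and> \<not> P z" using c by simp
  next
    fix x assume "\<exists>z. z + x = c \<and> \<not> P z"
    then obtain z where z: "z + x = c" "\<not> P z" by blast
    with 0 have "z \<noteq> 0" by auto
    then obtain y where "z = y + 1" using nonzero_Suc by blast
    with z Suc[of y] show "\<exists>z. z + (x + 1) = c \<and> \<not> P z"
      by (intro exI[of _ y]) (auto simp: ac_simps)
  qed
  then obtain z where "z + (c + 1) = c" by blast
  moreover have "c + 1 \<le> z + (c + 1)" for z by simp
  ultimately show False using less_succ[of c] by (metis not_less)
qed

text \<open>Collection bounds the witnesses for \<open>P\<close> and for its negation together, up
  to \<open>c\<close>. There \<open>P\<close> equals a bounded existential quantifier over a \<Pi>1
  matrix, hence is \<Pi>1.\<close>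

lemma ind_D2:
  assumes P: "D2 S (\<lambda>v. P (v 0))" and 0: "P 0" and Suc: "\<And>x. P x \<Longrightarrow> P (x + 1)"
  shows "P c"
proof -
  obtain R where R: "Pi S 1 (\<lambda>v. R (v 0) (v 1))" "\<And>x. P x \<longleftrightarrow> (\<exists>y. R y x)"
    using Sg_Suc_contract_binary[OF clos1, of P] D2_Sg[OF P] by (auto simp: numeral_2_eq_2)
  obtain T where T: "Pi S 1 (\<lambda>v. T (v 0) (v 1))" "\<And>x. \<not> P x \<longleftrightarrow> (\<exists>y. T y x)"
    using Sg_Suc_contract_binary[OF clos1, of "\<lambda>x. \<not> P x"] D2_Sg[OF D2_neg[OF P]]
    by (auto simp: numeral_2_eq_2)
  have "Sg S 2 (\<lambda>v. R (v 1) (v 0) \<or> T (v 1) (v 0))"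
    by (intro Sg2_disj D2_Sg D2_Pi1 dfn_swap[OF R(1)] dfn_swap[OF T(1)])
  then have "\<exists>b. \<forall>x<c+1. \<exists>y<b. R y x \<or> T y x"
    by (rule collection) (metis R(2) T(2))
  then obtain b where b0: "\<And>x. x < c + 1 \<Longrightarrow> \<exists>y<b. R y x \<or> T y x" by blast
  have b: "P x \<longleftrightarrow> (\<exists>y<b. R y x)" if "x < c + 1" for x
    using b0[OF that] R(2)[of x] T(2)[of x] by blast
  have "c \<le> c \<longrightarrow> (\<exists>y<b. R y c)"
  proof (rule ind_Pi1[where P = "\<lambda>x. x \<le> c \<longrightarrow> (\<exists>y<b. R y x)"])
    show "Pi S 1 (\<lambda>v. v 0 \<le> c \<longrightarrow> (\<exists>y<b. R y (v 0)))"
      unfolding imp_conv_disj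
      using R(1) by (intro Pi_disj[OF clos1 Bd_Pi] Pi_bex[OF clos1] Bd_neg Bd_le polyn_intros) simp
  next
    show "0 \<le> c \<longrightarrow> (\<exists>y<b. R y 0)"
      using b[of 0] 0 by (simp add: less_succ_iff)
  next
    fix x assume *: "x \<le> c \<longrightarrow> (\<exists>y<b. R y x)"
    show "x + 1 \<le> c \<longrightarrow> (\<exists>y<b. R y (x + 1))"
    proof
      assume "x + 1 \<le> c"
      then have le: "x < c + 1" "x \<le> c" "x + 1 < c + 1"
        by (simp_all add: less_succ_iff order_less_imp_le flip: less_iff_succ_le)
      then show "\<exists>y<b. R y (x + 1)"
        using * b[OF le(1)] b[OF le(3)] Suc[of x] by blast
    qed
  qed
  then show "P c" using b[OF less_succ] by simp
qed

lemma least_D2: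
  assumes P: "D2 S (\<lambda>v. P (v 0))" and "P a"
  obtains x where "P x" "\<And>y. y < x \<Longrightarrow> \<not> P y"
proof -
  have "\<exists>x. P x \<and> (\<forall>y<x. \<not> P y)"
  proof (rule ccontr)
    assume *: "\<nexists>x. P x \<and> (\<forall>y<x. \<not> P y)"
    have "\<forall>y<a+1. \<not> P y"
    proof (rule ind_D2[where P = "\<lambda>x. \<forall>y<x. \<not> P y"])
      show "D2 S (\<lambda>v. \<forall>y<v 0. \<not> P y)" by (intro D2_intros P)
    next
      show "\<forall>y<0. \<not> P y" by (simp add: not_less)
    next
      fix x assume "\<forall>y<x. \<not> P y"
      then show "\<forall>y<x+1. \<not> P y" using * by (auto simp: less_succ_iff order_le_less)
    qed
    with \<open>P a\<close> less_succ show False by blast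
  qed
  with that show ?thesis by blast
qed

end

section \<open>Arithmetic in \<open>PA\<^sup>-\<close>\<close>

lemma dvd_add_cancel: 
  assumes "(p::'m::pa_minus) dvd d + x" "p dvd x" shows "p dvd d"
proof -
  obtain k l where kl: "d + x = p * k" "x = p * l" using assms unfolding dvd_def by blast
  show ?thesis
  \<comment> \<open>In the absence of subtraction the quotients are compared; if
    \<open>k < l\<close>, then \<open>d + x \<le> x\<close> forces \<open>d = 0\<close>.\<close>
  proof (cases "l \<le> k")
    case True
    then obtain j where "k = l + j" by (auto simp: le_iff_add)
    with kl have "p * l + d = p * l + p * j" by (simp add: algebra_simps)
    then show ?thesis by simp
  next
    case False
    then have "p * k \<le> p * l" by (simp add: mult_left_mono)
    with kl have "d + x \<le> 0 + x" by simp
    then have "d = 0" by (simp only: add_le_cancel_right) simp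
    then show ?thesis by simp
  qed
qed

lemma le_mult_self: "(z::'m::pa_minus) \<le> z * z"
proof (cases "z = 0")
  case False
  then have "1 \<le> z" using discrete by (simp add: zero_less_iff_neq_zero)
  from mult_left_mono[OF this, of z] show ?thesis by simp
qed simp

lemma le_mult_right: "0 < (d::'m::pa_minus) \<Longrightarrow> k \<le> d * k"
  using mult_right_mono[OF discrete, of d k] by simp

lemma dvd_iff_bounded: "(d::'m::pa_minus) dvd m \<longleftrightarrow> (\<exists>k<m+1. m = d * k)"
proof (cases "m = 0")
  case True
  then show ?thesis by (auto intro!: exI[of _ 0])
next
  case False
  then show ?thesis
    unfolding dvd_def less_succ_iff using le_mult_right[of d]
    by (metis mult_zero_left zero_less_iff_neq_zero)
qed

lemma Bd_dvd: "polyn f \<Longrightarrow> polyn g \<Longrightarrow> Bd S (\<lambda>v. f v dvd g v)"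
  unfolding dvd_iff_bounded by (intro Bd_intros polyn_tail)

lemma div_unique:
  assumes "q * m + r = q' * m + (r'::'m::pa_minus)" "r < m" "r' < m"
  shows "r = r'"
proof -
  have *: "\<not> q < q'" if "q * m + r = q' * m + (r'::'m)" "r < m" for q q' r r'
  proof
    assume "q < q'"
    then have "(q + 1) * m \<le> q' * m" by (intro mult_right_mono) (auto simp: less_iff_succ_le)
    also have "\<dots> \<le> q' * m + r'" by simp
    also have "\<dots> = q * m + r" using that by simp
    also have "\<dots> < (q + 1) * m" using that(2) by (simp add: distrib_right)
    finally show False by simp
  qed
  from *[OF assms(1,2)] *[OF assms(1)[symmetric] assms(3)] have "q = q'" by auto
  with assms(1) show ?thesis by simp
qed

section \<open>The pairing function\<close>

lemma cpair_inj [simp]: "cpair x y = cpair x' y' \<longleftrightarrow> x = x' \<and> (y::'m::pa_minus) = y'"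
proof
  have *: "\<not> x + y < x' + y'" if "cpair x y = cpair x' (y'::'m)" for x y x' y'
  proof
    assume "x + y < x' + y'"
    then have le: "x + y + 1 \<le> x' + y'" by (simp add: less_iff_succ_le)
    have "cpair x y < (x + y + 1) * (x + y + 1)"
    proof -
      have "x < (x + y) + (x + y) + 1" unfolding less_succ_iff by (simp add: add.assoc)
      then have "(x + y) * (x + y) + x < (x + y) * (x + y) + ((x + y) + (x + y) + 1)" by simp
      also have "\<dots> = (x + y + 1) * (x + y + 1)" by (simp add: algebra_simps)
      finally show ?thesis by (simp add: cpair_def)
    qed
    also have "\<dots> \<le> (x' + y') * (x' + y')" using le by (intro mult_mono) auto
    also have "\<dots> \<le> cpair x' y'" by (simp add: cpair_def)
    finally show False using that by simp
  qed
  assume eq: "cpair x y = cpair x' y'"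
  from *[OF eq] *[OF eq[symmetric]] have s: "x + y = x' + y'" by auto
  with eq have "x = x'" by (simp add: cpair_def)
  with s show "x = x' \<and> y = y'" by simp
qed auto

lemma polyn_cpair: "polyn f \<Longrightarrow> polyn g \<Longrightarrow> polyn (\<lambda>v. cpair (f v) (g v))"
  unfolding cpair_def by (intro polyn_intros)

lemma le_cpair: "(x::'m::pa_minus) \<le> cpair x y" "y \<le> cpair x (y::'m::pa_minus)"
proof -
  show "x \<le> cpair x y" by (simp add: cpair_def)
  have "y \<le> x + y" by simp
  also have "\<dots> \<le> (x + y) * (x + y)" by (rule le_mult_self)
  also have "\<dots> \<le> cpair x y" by (simp add: cpair_def)
  finally show "y \<le> cpair x y" .
qed

lemma cpair_mono: "x \<le> x' \<Longrightarrow> y \<le> y' \<Longrightarrow> cpair x y \<le> cpair x' (y'::'m::pa_minus)"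
  unfolding cpair_def by (intro add_mono mult_mono) auto

lemma cpair_strict_mono: "y < y' \<Longrightarrow> cpair x y < cpair x (y'::'m::pa_minus)"
  by (simp add: order_less_le cpair_mono)

text \<open>
  The moduli of Goedel's beta function. They are pairwise coprime below \<open>a\<close> if \<open>m\<close> is divisible
  by all positive numbers up to \<open>a\<close>.
\<close>

definition modulus :: "'m::pa_minus \<Rightarrow> 'm \<Rightarrow> 'm" where
  "modulus m x = 1 + (x + 1) * m"

lemma polyn_modulus: "polyn f \<Longrightarrow> polyn g \<Longrightarrow> polyn (\<lambda>v. modulus (f v) (g v))"
  unfolding modulus_def by (intro polyn_intros)

definition smooth :: "'m::pa_minus \<Rightarrow> 'm \<Rightarrow> bool" where
  "smooth a m \<longleftrightarrow> 0 < m \<and> (\<forall>d<a+1. d = 0 \<or> d dvd m)"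

text \<open>Let \<open>p\<close>, \<open>q\<close> be the moduli of \<open>x\<close>,
  \<open>y\<close>. With \<open>z\<close>, \<open>d\<close>, \<open>e\<close> as in the proof,
  \<open>(z + d) * p - z * q = d\<close> and \<open>p - z * m = 1\<close>, where
  \<open>m = d * e\<close>; hence \<open>p - z * e * ((z + d) * p - z * q) = 1\<close>. Adding a
  suitable multiple of \<open>p * q\<close> to both sides removes the subtractions.\<close>

lemma bezout_less:
  assumes "x < y" "y < a" "smooth a (m::'m::pa_minus)"
  shows "\<exists>u v. u * modulus m x = 1 + v * modulus m y" and "\<exists>u v. u * modulus m y = 1 + v * modulus m x"
proof -
  obtain d where d: "y = x + d" "0 < d"
    using assms(1) by (metis canonically_ordered_monoid_add_class.lessE zero_less_iff_neq_zero)
  have "d < a + 1"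
    using assms(2) d by (metis add.commute le_add_same_cancel1 le_less_trans less_succ order_less_trans zero_le)
  then obtain e where e: "m = d * e"
    using assms(3) d unfolding smooth_def by (auto simp: dvd_def)
  define z where "z = x + 1"
  have m: "modulus m x = 1 + z * m" "modulus m y = 1 + (z + d) * m"
    by (simp_all add: modulus_def z_def d algebra_simps)
  have "(1 + z * (z + d) * (z + d) * e * m) * modulus m x = 1 + z * e * (d + z * (z + d) * m) * modulus m y"
    unfolding m by (simp add: e algebra_simps)
  then show "\<exists>u v. u * modulus m x = 1 + v * modulus m y" by blast
  have "(z * z * e + modulus m x) * modulus m y = 1 + (z * (z + d) * e + (z + d) * m) * modulus m x"
    unfolding m by (simp add: e algebra_simps)
  then show "\<exists>u v. u * modulus m y = 1 + v * modulus m x" by blast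
qed

lemma bezout:
  assumes "x \<noteq> y" "x < a" "y < a" "smooth a (m::'m::pa_minus)"
  shows "\<exists>u v. u * modulus m x = 1 + v * modulus m y"
  using assms bezout_less[of x y a m] bezout_less[of y x a m] by (metis linorder_neqE)

lemma gauss:
  assumes "u * p = 1 + v * (q::'m::pa_minus)" "p dvd q * d" shows "p dvd d"
proof -
  have "d + v * (q * d) = p * (u * d)"
    using arg_cong[OF assms(1), of "\<lambda>x. x * d"] by (simp add: algebra_simps)
  then have "p dvd d + v * (q * d)" by simp
  moreover have "p dvd v * (q * d)" using assms(2) by (rule dvd_mult)
  ultimately show ?thesis by (rule dvd_add_cancel)
qed

section \<open>Coding of bounded sets and sequences\<close>

definition coded :: "'m::pa_minus \<Rightarrow> 'm \<Rightarrow> 'm \<Rightarrow> bool" where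
  "coded m D x \<longleftrightarrow> modulus m x dvd D"

lemma Bd_coded: "polyn f \<Longrightarrow> polyn g \<Longrightarrow> polyn h \<Longrightarrow> Bd S (\<lambda>v. coded (f v) (g v) (h v))"
  unfolding coded_def by (intro Bd_dvd polyn_modulus)

text \<open>\<open>N\<close> bounds a code for every \<open>D2\<close> set of numbers below
  \<open>a\<close>, so that a search through the codes is a bounded search.\<close>

definition code_bound :: "'m::pa_minus \<Rightarrow> 'm \<Rightarrow> 'm \<Rightarrow> bool" where
  "code_bound a m N \<longleftrightarrow> smooth a m \<and> 0 < N \<and> (\<forall>x<a. modulus m x dvd N)"

lemma less_one_iff [simp]: "(d::'m::pa_minus) < 1 \<longleftrightarrow> d = 0"
  using discrete[of d] by (metis not_gr_zero not_less zero_less_one)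

lemma one_less_modulus: "0 < m \<Longrightarrow> 1 < modulus m (x::'m::pa_minus)"
  unfolding modulus_def by (metis add.commute less_succ less_add_same_cancel1 mult_pos_pos order_le_less_trans zero_le)

lemma Sg_imp: "clos S n \<Longrightarrow> Bd S P \<Longrightarrow> Sg S n Q \<Longrightarrow> Sg S n (\<lambda>v. P v \<longrightarrow> Q v)"
  unfolding imp_conv_disj by (intro Sg_disj Bd_Sg[OF Bd_neg])

lemma dfn_vars2: "dfn S C (\<lambda>v. R (v 0) (v (Suc 0))) \<Longrightarrow> dfn S C (\<lambda>v. R (v i) (v j))"
  using dfn_env[of S C "\<lambda>v. R (v 0) (v 1)" "\<lambda>k. Inl (if k = 0 then i else j)"] by (simp add: env_def)

context bs2
begin

text \<open>A factorial in disguise: the product of the positive numbers up to \<open>a\<close>,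
  obtained by \<Sigma>1 induction.\<close>

lemma smooth_exists: "\<exists>m. smooth a (m::'m)"
proof (rule ind_Sg1[where P = "\<lambda>a. \<exists>m. smooth a m"])
  show "Sg S 1 (\<lambda>v. \<exists>m. smooth (v 0) m)"
    unfolding smooth_def One_nat_def by (intro Sg_ex Bd_Sg Bd_intros Bd_dvd)
  have "smooth 0 (1::'m)" by (auto simp: smooth_def less_succ_iff)
  then show "\<exists>m. smooth 0 (m::'m)" by blast
next
  fix a :: 'm assume "\<exists>m. smooth a m"
  then obtain m where m: "0 < m" "\<And>d. d < a + 1 \<Longrightarrow> d = 0 \<or> d dvd m" by (auto simp: smooth_def)
  have "0 < a + 1" by (metis less_succ not_gr_zero not_less_zero)
  moreover have "d = 0 \<or> d dvd m * (a + 1)" if "d < a + 1 + 1" for d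
    using m(2)[of d] that by (cases "d = a + 1") (auto simp: less_succ_iff[of d "a + 1"] order_le_less)
  ultimately have "smooth (a + 1) (m * (a + 1))"
    unfolding smooth_def using m(1) by (auto intro: mult_pos_pos)
  then show "\<exists>m. smooth (a + 1) m" by blast
qed

lemma code_bound_exists: obtains m N where "code_bound (a::'m) m N"
proof -
  obtain m where m: "smooth a m" using smooth_exists by blast
  have "\<exists>N. 0 < N \<and> (\<forall>x<a. modulus m x dvd N)"
  proof (rule ind_Sg1[where P = "\<lambda>a. \<exists>N. 0 < N \<and> (\<forall>x<a. modulus m x dvd N)"])
    show "Sg S 1 (\<lambda>v. \<exists>N. 0 < N \<and> (\<forall>x<v 0. modulus m x dvd N))"
      unfolding One_nat_def by (intro Sg_ex Bd_Sg Bd_intros Bd_dvd polyn_modulus)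
    show "\<exists>N. 0 < N \<and> (\<forall>x<(0::'m). modulus m x dvd N)" by (auto intro: exI[of _ 1])
  next
    fix a :: 'm assume "\<exists>N. 0 < N \<and> (\<forall>x<a. modulus m x dvd N)"
    then obtain N where N: "0 < N" "\<And>x. x < a \<Longrightarrow> modulus m x dvd N" by blast
    have "0 < modulus m a" using one_less_modulus[of m a] m
      by (auto simp: smooth_def intro: order_less_trans[OF zero_less_one])
    with N have "0 < N * modulus m a \<and> (\<forall>x<a+1. modulus m x dvd N * modulus m a)"
      by (auto simp: less_succ_iff order_le_less)
    then show "\<exists>N. 0 < N \<and> (\<forall>x<a+1. modulus m x dvd N)" by blast
  qed
  with m that show ?thesis unfolding code_bound_def by blast
qed

text \<open>The least positive number divisible by all the moduli selected by \<open>P\<close> is a code of \<open>P\<close>.\<close>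

lemma coding:
  assumes ab: "code_bound a m N" and P: "D2 S (\<lambda>v. P (v 0))"
  shows "\<exists>D\<le>N. \<forall>x<a. coded m D x = P x"
proof -
  have sm: "smooth a m" and m: "0 < m" using ab by (auto simp: code_bound_def smooth_def)
  let ?Q = "\<lambda>D. 0 < D \<and> (\<forall>x<a. P x \<longrightarrow> modulus m x dvd D)"
  have "D2 S (\<lambda>v. ?Q (v 0))"
    by (intro D2_intros D2_Bd[OF Bd_dvd] polyn_modulus P)
  moreover have "?Q N" using ab by (auto simp: code_bound_def)
  ultimately obtain D where D: "?Q D" "\<And>y. y < D \<Longrightarrow> \<not> ?Q y" by (rule least_D2) blast
  have "P x" if x: "x < a" "coded m D x" for x
  proof (rule ccontr)
    assume nP: "\<not> P x"
    \<comment> \<open>Dividing out the modulus of a wrongly coded \<open>x\<close> gives a smaller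
      positive number; by coprimality all selected moduli still divide it, against
      minimality.\<close>
    obtain E where E: "D = modulus m x * E" using x(2) by (auto simp: coded_def dvd_def)
    with D(1) have "0 < E" by (metis mult_zero_right not_gr_zero)
    from mult_strict_right_mono[OF one_less_modulus[OF m] this] E have "E < D" by simp
    moreover have "modulus m y dvd E" if y: "y < a" "P y" for y
    proof -
      have "y \<noteq> x" using y nP by auto
      from bezout[OF this y(1) x(1) sm] obtain u v where "u * modulus m y = 1 + v * modulus m x" by blast
      moreover have "modulus m y dvd modulus m x * E" using D(1) y E by simp
      ultimately show ?thesis by (rule gauss)
    qed
    ultimately show False using D(2)[of E] \<open>0 < E\<close> by blast
  qed
  then have "\<forall>x<a. coded m D x = P x" using D(1) by (auto simp: coded_def)
  moreover have "D \<le> N" using D(2)[of N] \<open>?Q N\<close> by (metis not_less)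
  ultimately show ?thesis by blast
qed

text \<open>If every code up to \<open>N\<close> failed, collection would bound by one
  \<open>b\<close> the stages at which the failures show. But \<open>Q0\<close> cut off at stage
  \<open>b\<close> is \<open>D2\<close>, so it has a code, and by disjointness from
  \<open>Q1\<close> this code does not fail by stage \<open>b\<close>.\<close>

lemma separation:
  assumes ab: "code_bound a m N" and Q0: "Sg S 2 (\<lambda>v. Q0 (v 0))" and Q1: "Sg S 2 (\<lambda>v. Q1 (v 0))"
    and disj: "\<And>x. x < a \<Longrightarrow> Q0 x \<Longrightarrow> Q1 x \<Longrightarrow> False"
  obtains D where "D \<le> N" "\<And>x. x < a \<Longrightarrow> Q0 x \<Longrightarrow> coded m D x" "\<And>x. x < a \<Longrightarrow> Q1 x \<Longrightarrow> \<not> coded m D x"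
proof -
  obtain R0 where R0: "Pi S 1 (\<lambda>v. R0 (v 0) (v 1))" "\<And>x. Q0 x \<longleftrightarrow> (\<exists>y. R0 y x)"
    using Sg_Suc_contract_binary[OF clos1, of Q0] Q0 by (auto simp: numeral_2_eq_2)
  obtain R1 where R1: "Pi S 1 (\<lambda>v. R1 (v 0) (v 1))" "\<And>x. Q1 x \<longleftrightarrow> (\<exists>y. R1 y x)"
    using Sg_Suc_contract_binary[OF clos1, of Q1] Q1 by (auto simp: numeral_2_eq_2)
  note D0 = D2_Pi1[OF R0(1), unfolded One_nat_def] and D1 = D2_Pi1[OF R1(1), unfolded One_nat_def]
  define bad where "bad D t \<longleftrightarrow> (\<exists>x<a. (\<exists>y<t. R0 y x) \<and> \<not> coded m D x \<or> (\<exists>y<t. R1 y x) \<and> coded m D x)" for D t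
  have "\<exists>D<N+1. \<forall>t. \<not> bad D t"
  proof (rule ccontr)
    assume "\<not> ?thesis"
    then have "\<And>D. D < N + 1 \<Longrightarrow> \<exists>t. bad D t" by blast
    moreover have "Sg S 2 (\<lambda>v. bad (v 0) (v 1))"
      unfolding bad_def by (intro D2_Sg D2_intros D2_Bd[OF Bd_coded] D0 D1)
    ultimately have "\<exists>b. \<forall>D<N+1. \<exists>t<b. bad D t"
      by (intro collection)
    then obtain b where b: "\<And>D. D < N + 1 \<Longrightarrow> \<exists>t<b. bad D t" by blast
    have "D2 S (\<lambda>v. \<exists>y<b. R0 y (v 0))" by (intro D2_intros D0)
    from coding[OF ab this] obtain D where D: "D \<le> N" "\<And>x. x < a \<Longrightarrow> coded m D x = (\<exists>y<b. R0 y x)" by blast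
    from b[of D] D(1) obtain t x where t: "t < b" "x < a"
      and *: "(\<exists>y<t. R0 y x) \<and> \<not> coded m D x \<or> (\<exists>y<t. R1 y x) \<and> coded m D x"
      unfolding bad_def less_succ_iff by blast
    from * show False
    proof
      assume "(\<exists>y<t. R0 y x) \<and> \<not> coded m D x"
      then show False using D(2)[OF t(2)] t(1) by (meson order_less_trans)
    next
      assume "(\<exists>y<t. R1 y x) \<and> coded m D x"
      then show False using D(2)[OF t(2)] disj[OF t(2)] R0(2)[of x] R1(2)[of x] by blast
    qed
  qed
  then obtain D where "D < N + 1 \<and> (\<forall>t. \<not> bad D t)" by (rule exE)
  then have D: "D \<le> N" "\<And>t. \<not> bad D t" by (simp_all add: less_succ_iff)
  have "coded m D x" if x: "x < a" and Q: "Q0 x" for x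
  proof -
    obtain y where y: "R0 y x" using Q R0(2)[of x] by blast
    show ?thesis using D(2)[of "y + 1"] x y less_succ[of y] unfolding bad_def by blast
  qed
  moreover have "\<not> coded m D x" if x: "x < a" and Q: "Q1 x" for x
  proof -
    obtain y where y: "R1 y x" using Q R1(2)[of x] by blast
    show ?thesis using D(2)[of "y + 1"] x y less_succ[of y] unfolding bad_def by blast
  qed
  ultimately show ?thesis using that D(1) by blast
qed

text \<open>Chinese remaindering by \<Sigma>1 induction on the number \<open>k\<close> of
  congruences already solved by \<open>A\<close>. The induction also carries a common multiple
  \<open>N\<close> of the first \<open>k\<close> moduli, with Bezout equations against the remaining
  ones.\<close>

lemma beta:
  assumes R: "Sg S 1 (\<lambda>v. R (v 0) (v 1))"
    and ex: "\<And>i. i < n \<Longrightarrow> \<exists>r. R i r" and un: "\<And>i r r'. i < n \<Longrightarrow> R i r \<Longrightarrow> R i r' \<Longrightarrow> r = r'"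
    and K: "\<And>i r. i < n \<Longrightarrow> R i r \<Longrightarrow> r < K"
  shows "\<exists>s. \<forall>i<n. \<forall>r. entry s i r = R i r"
proof -
  \<comment> \<open>With \<open>n + K\<close> in place of \<open>n\<close>, the moduli are not only
    pairwise coprime but also exceed every value below \<open>K\<close>.\<close>
  obtain b where b: "smooth (n + K) (b::'m)" using smooth_exists by blast
  define q where "q = modulus b"
  have Kb: "K \<le> b"
  proof (cases "K = 0")
    case False
    moreover have "K < n + K + 1" unfolding less_succ_iff by (simp add: add_increasing)
    ultimately have "K dvd b" using b unfolding smooth_def by blast
    then obtain k where k: "b = K * k" by (auto simp: dvd_def)
    then have "0 < k" using b by (metis mult_zero_right not_gr_zero smooth_def)
    from le_mult_right[OF this, of K] k show ?thesis by (simp add: mult.commute)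
  qed simp
  have Rq: "r < q i" if "i < n" "R i r" for i r
  proof -
    have "r < b" using K[OF that] Kb by simp
    also have "\<dots> \<le> (i + 1) * b" using mult_right_mono[of 1 "i + 1" b] by simp
    also have "\<dots> \<le> q i" by (simp add: q_def modulus_def)
    finally show ?thesis .
  qed
  have bz: "\<exists>u v. u * q i = 1 + v * q j" if "i \<noteq> j" "i < n" "j < n" for i j
    unfolding q_def using that
    by (intro bezout[OF _ _ _ b]) (auto intro: order_less_le_trans)
  let ?P = "\<lambda>k. k \<le> n \<longrightarrow> (\<exists>A N. (\<forall>i<k. q i dvd N \<and> (\<exists>r<q i. \<exists>t<A+1. A = t * q i + r \<and> R i r)) \<and>
      (\<forall>j<n. k \<le> j \<longrightarrow> (\<exists>u v. u * N = 1 + v * q j)))"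
  have "?P n"
  proof (rule ind_Sg1[where P = ?P])
    show "Sg S 1 (\<lambda>v. ?P (v 0))"
      using R unfolding One_nat_def q_def
      by (intro Sg_imp[OF clos1[unfolded One_nat_def]] Sg_conj[OF clos1[unfolded One_nat_def]]
          Sg_ball[OF clos1[unfolded One_nat_def]] Sg_bex[OF clos1[unfolded One_nat_def]]
          Bd_le Bd_Sg[OF Bd_le] Bd_Sg[OF Bd_eq] Bd_Sg[OF Bd_dvd] Sg_ex polyn_modulus polyn_intros)
        (erule dfn_vars2)
  next
    have "\<exists>u v. u * 1 = 1 + v * q j" for j by (rule exI[of _ 1], rule exI[of _ 0]) simp
    then show "?P 0" by - (rule impI, rule exI[of _ 0], rule exI[of _ 1], simp)
  next
    fix k assume IH: "?P k"
    show "?P (k + 1)"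
    proof
      assume "k + 1 \<le> n"
      then have kn: "k < n" by (simp add: less_iff_succ_le)
      from mp[OF IH order_less_imp_le[OF kn]] obtain A N where A: "\<And>i. i < k \<Longrightarrow> q i dvd N"
          "\<And>i. i < k \<Longrightarrow> \<exists>r<q i. \<exists>t<A+1. A = t * q i + r \<and> R i r"
        and N: "\<And>j. j < n \<Longrightarrow> k \<le> j \<Longrightarrow> \<exists>u v. u * N = 1 + v * q j"
        by blast
      obtain r0 where r0: "R k r0" using ex[OF kn] by blast
      obtain u w where u: "u * N = 1 + w * q k" using N[OF kn] by blast
      \<comment> \<open>Modulo \<open>q k\<close>, \<open>N * u\<close> is 1 and
        \<open>(k + 1) * b\<close> is -1; so \<open>C\<close> stands for \<open>r0 - A\<close>, and
        adding \<open>N * u * C\<close> gives the remainder \<open>r0\<close> at \<open>k\<close>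
        without disturbing the earlier remainders.\<close>
      define C where "C = r0 + A * ((k + 1) * b)"
      define A' where "A' = A + N * u * C"
      have A'k: "A' = (A + w * C) * q k + r0"
      proof -
        have "A' = A + (1 + w * q k) * C" by (simp add: A'_def flip: u) (simp add: ac_simps)
        also have "\<dots> = A + A * ((k + 1) * b) + w * q k * C + r0" by (simp add: C_def algebra_simps)
        also have "A + A * ((k + 1) * b) = A * q k" by (simp add: q_def modulus_def algebra_simps)
        finally show ?thesis by (simp add: algebra_simps)
      qed
      have q0: "t < A + 1" if "A = t * q i + r" for t A r i
      proof -
        have "t * 1 \<le> t * q i" by (intro mult_left_mono) (auto simp: q_def modulus_def)
        then show ?thesis unfolding less_succ_iff that by (metis add_increasing2 mult.right_neutral zero_le)
      qed
      have "q i dvd N * q k \<and> (\<exists>r<q i. \<exists>t<A'+1. A' = t * q i + r \<and> R i r)" if "i < k + 1" for i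
      proof (cases "i = k")
        case True
        then show ?thesis using A'k r0 Rq[OF kn r0] q0[OF A'k] by auto
      next
        case False
        with that have i: "i < k" by (auto simp: less_succ_iff)
        obtain l where l: "N = q i * l" using A(1)[OF i] by (auto simp: dvd_def)
        obtain r t where rt: "r < q i" "A = t * q i + r" "R i r" using A(2)[OF i] by blast
        have *: "A' = (t + l * u * C) * q i + r" unfolding A'_def rt(2) l by (simp add: algebra_simps)
        show ?thesis using rt(1,3) * q0[OF *] A(1)[OF i] by auto
      qed
      moreover have "\<exists>u v. u * (N * q k) = 1 + v * q j" if j: "j < n" "k + 1 \<le> j" for j
      proof -
        have "k < j" using j(2) by (simp add: less_iff_succ_le)
        obtain u v where 1: "u * N = 1 + v * q j" using N[OF j(1) order_less_imp_le[OF \<open>k < j\<close>]] by blast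
        obtain u' v' where 2: "u' * q k = 1 + v' * q j" using bz[OF less_imp_neq[OF \<open>k < j\<close>] kn j(1)] by blast
        have "(u * u') * (N * q k) = (u * N) * (u' * q k)" by (simp add: ac_simps)
        also have "\<dots> = 1 + (v + v' + v * v' * q j) * q j" unfolding 1 2 by (simp add: algebra_simps)
        finally show ?thesis by blast
      qed
      ultimately show "\<exists>A N. (\<forall>i<k+1. q i dvd N \<and> (\<exists>r<q i. \<exists>t<A+1. A = t * q i + r \<and> R i r)) \<and>
          (\<forall>j<n. k + 1 \<le> j \<longrightarrow> (\<exists>u v. u * N = 1 + v * q j))" by blast
    qed
  qed
  then obtain A where A: "\<And>i. i < n \<Longrightarrow> \<exists>r<q i. \<exists>t<A+1. A = t * q i + r \<and> R i r" by auto
  have "entry (cpair A b) i r = R i r" if i: "i < n" for i r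
  proof -
    obtain r' t where r': "r' < q i" "A = t * q i + r'" "R i r'" using A[OF i] by blast
    have "entry (cpair A b) i r \<longleftrightarrow> (\<exists>t. A = t * q i + r \<and> r < q i)"
      by (auto simp: entry_def q_def modulus_def)
    also have "\<dots> \<longleftrightarrow> r = r'"
      using r' div_unique by metis
    also have "\<dots> \<longleftrightarrow> R i r" using r'(3) un[OF i] by blast
    finally show ?thesis .
  qed
  then show ?thesis by blast
qed

end

section \<open>Types over a cut\<close>

lemma dfn_sub2:
  assumes R: "dfn S C (\<lambda>v. R (v 0) (v 1))" and f: "polyn f" and g: "polyn g"
    and C: "\<And>h \<tau> \<phi>. C \<phi> \<Longrightarrow> C (sub h \<tau> \<phi>)"
  shows "dfn S C (\<lambda>v. R (f v) (g v))"
proof -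
  have "dfn S C (\<lambda>v. R (v 0) (g (\<lambda>i. v (Suc i))))"
    using dfn_subst[of S C "\<lambda>x u. R (u 0) x", OF _ polyn_tail[OF g] C] dfn_swap[OF R] by simp
  from dfn_subst[of S C "\<lambda>x u. R x (g u)", OF this f C] show ?thesis .
qed

lemma dfn_sub3:
  assumes R: "dfn S C (\<lambda>v. R (v 0) (v 1) (v 2))" and f: "polyn f" and g: "polyn g" and h: "polyn h"
    and C: "\<And>h \<tau> \<phi>. C \<phi> \<Longrightarrow> C (sub h \<tau> \<phi>)"
  shows "dfn S C (\<lambda>v. R (f v) (g v) (h v))"
proof -
  have "dfn S C (\<lambda>v. R (v 1) (v 2) (v 0))"
    using dfn_env[OF R, of "\<lambda>i. Inl (if i = 0 then 1 else if i = 1 then 2 else 0)"]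
    by (simp add: env_def)
  then have "dfn S C (\<lambda>v. R (v 0) (v 1) (h (\<lambda>i. v (Suc (Suc i)))))"
    using dfn_subst[of S C "\<lambda>x u. R (u 0) (u 1) x", OF _ polyn_tail[OF polyn_tail[OF h]] C]
    by (simp add: numeral_2_eq_2)
  from dfn_env[OF this, of "\<lambda>i. Inl (case i of 0 \<Rightarrow> 1 | Suc i \<Rightarrow> case i of 0 \<Rightarrow> 0 | Suc i \<Rightarrow> Suc (Suc i))"]
  have "dfn S C (\<lambda>v. R (v 1) (v 0) (h (\<lambda>i. v (Suc (Suc i)))))"
    by (simp add: env_def)
  then have "dfn S C (\<lambda>v. R (v 0) (g (\<lambda>i. v (Suc i))) (h (\<lambda>i. v (Suc i))))"
    using dfn_subst[of S C "\<lambda>x u. R (u 0) x (h (\<lambda>i. u (Suc i)))", OF _ polyn_tail[OF g] C] by simp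
  from dfn_subst[of S C "\<lambda>x u. R x (g u) (h u)", OF this f C] show ?thesis .
qed

lemma D2_sub2: "D2 S (\<lambda>v. R (v 0) (v 1)) \<Longrightarrow> polyn f \<Longrightarrow> polyn g \<Longrightarrow> D2 S (\<lambda>v. R (f v) (g v))"
  unfolding D2_def by (auto intro: dfn_sub2 sigma_pi_sub)

lemma D2_sub3: "D2 S (\<lambda>v. R (v 0) (v 1) (v 2)) \<Longrightarrow> polyn f \<Longrightarrow> polyn g \<Longrightarrow> polyn h \<Longrightarrow>
    D2 S (\<lambda>v. R (f v) (g v) (h v))"
  unfolding D2_def by (auto intro: dfn_sub3 sigma_pi_sub)

lemma D2_sub1: "D2 S (\<lambda>v. R (v 0)) \<Longrightarrow> polyn f \<Longrightarrow> D2 S (\<lambda>v. R (f v))"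
  using D2_subst[of S "\<lambda>x v. R x"] by simp

text \<open>\<open>\<rho> x u\<close> is to be read as: by stage \<open>u\<close>, \<open>x\<close>
  has been enumerated into the cut \<open>I\<close>. \<open>S\<close> is the richer structure, in
  which overspill is available; \<open>A\<close> is the one in which the results have to be
  definable.\<close>

locale cut = s: bs2 S + a: bs2 A for S A :: "nat \<Rightarrow> 'm::pa_minus set" +
  fixes \<rho> :: "'m \<Rightarrow> 'm \<Rightarrow> bool" and I :: "'m \<Rightarrow> bool" and b :: 'm
  assumes D2_A_S: "D2 A P \<Longrightarrow> D2 S P"
    and rho: "D2 A (\<lambda>v. \<rho> (v 0) (v 1))"
    and I_iff: "I x \<longleftrightarrow> (\<exists>u. \<rho> x u)"
    and rho_mono: "\<rho> x u \<Longrightarrow> y \<le> x \<Longrightarrow> u \<le> w \<Longrightarrow> \<rho> y w"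
    and I_0: "I 0" and I_Suc: "I x \<Longrightarrow> I (x + 1)" and not_I: "\<not> I b"
begin

lemma I_down: "I x \<Longrightarrow> y \<le> x \<Longrightarrow> I y"
  using rho_mono unfolding I_iff by blast

lemma I_less: "I x \<Longrightarrow> \<not> I l \<Longrightarrow> x < l"
  using I_down[of x l] by (meson not_less)

text \<open>Overspill: a proper cut closed under successor would violate \<open>D2\<close>
  induction, so a \<open>D2\<close> predicate that holds on all of \<open>I\<close> also holds
  somewhere outside.\<close>

lemma I_not_D2: "D2 S (\<lambda>v. P (v 0)) \<Longrightarrow> \<exists>x. P x \<noteq> I x"
  using s.ind_D2[of P b] I_0 I_Suc not_I by blast

lemmas D2_rho = D2_sub2[OF rho]

text \<open>Otherwise the single stage \<open>u\<close> would decide \<open>I\<close>, making it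
  \<open>D2\<close>.\<close>

lemma cofinal: "\<exists>k. I k \<and> \<not> \<rho> k u"
proof -
  obtain x where "\<rho> x u \<noteq> I x"
    using I_not_D2[of "\<lambda>x. \<rho> x u"] D2_A_S[OF D2_rho] polyn_intros by blast
  then show ?thesis unfolding I_iff by blast
qed

definition F :: "'m \<Rightarrow> 'm \<Rightarrow> bool" where
  "F k u \<longleftrightarrow> \<rho> k u \<and> (\<forall>w<u. \<not> \<rho> k w)"

lemma D2_F: "polyn f \<Longrightarrow> polyn g \<Longrightarrow> D2 A (\<lambda>v. F (f v) (g v))"
  unfolding F_def by (intro a.D2_intros D2_rho polyn_tail)

lemma F_exists: "I k \<Longrightarrow> \<exists>u. F k u"
  unfolding I_iff F_def
  using a.least_D2[of "\<rho> k"] D2_rho[of "\<lambda>_. k" "\<lambda>v. v 0"] polyn_intros by metis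

lemma F_le: "F k u \<Longrightarrow> \<rho> k w \<Longrightarrow> u \<le> w"
  unfolding F_def by (meson not_less)

lemma F_unique: "F k u \<Longrightarrow> F k w \<Longrightarrow> u = w"
  by (meson F_def F_le order_antisym)

lemma I_bound:
  assumes "I k" "I j" obtains u where "\<rho> k u" "\<rho> j u"
proof -
  have "I (max k j)" using assms by (simp add: max_def)
  then show ?thesis using that rho_mono unfolding I_iff by (meson max.cobounded1 max.cobounded2 order_refl)
qed

end

text \<open>
  \<open>T x k j\<close> is the \<open>(k, j)\<close>-th bit of the type of \<open>x\<close>; \<open>F k u\<close> says that \<open>u\<close> is the value at
  \<open>k\<close> of a cofinal map defined on the cut \<open>I\<close>.
\<close>

locale cut_types = cut S A for S A :: "nat \<Rightarrow> 'm::pa_minus set" +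
  fixes \<theta> :: "'m \<Rightarrow> 'm \<Rightarrow> 'm \<Rightarrow> bool"
  assumes theta: "D2 A (\<lambda>v. \<theta> (v 0) (v 1) (v 2))"
begin

lemmas D2_theta = D2_sub3[OF theta]

definition T :: "'m \<Rightarrow> 'm \<Rightarrow> 'm \<Rightarrow> bool" where
  "T x k j \<longleftrightarrow> (\<exists>p q. F k p \<and> F j q \<and> (\<exists>y<p. \<forall>z<q. \<theta> x y z))"

text \<open>The values of \<open>F\<close> are unbounded, so \<open>T\<close> is not visibly
  \<open>D2\<close>. Searching for them only up to \<open>u\<close> is, and it is exact once the
  stage \<open>u\<close> covers \<open>k\<close> and \<open>j\<close>, because \<open>F\<close>
  picks the least stage.\<close>

definition Tb :: "'m \<Rightarrow> 'm \<Rightarrow> 'm \<Rightarrow> 'm \<Rightarrow> bool" where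
  "Tb u x k j \<longleftrightarrow> (\<exists>p<u+1. \<exists>q<u+1. F k p \<and> F j q \<and> (\<exists>y<p. \<forall>z<q. \<theta> x y z))"

lemma D2_Tb: "polyn f \<Longrightarrow> polyn g \<Longrightarrow> polyn h \<Longrightarrow> polyn l \<Longrightarrow> D2 A (\<lambda>v. Tb (f v) (g v) (h v) (l v))"
  unfolding Tb_def by (intro a.D2_intros D2_F D2_theta polyn_tail)

lemma Tb_iff_T: "\<rho> k u \<Longrightarrow> \<rho> j u \<Longrightarrow> Tb u x k j \<longleftrightarrow> T x k j"
  unfolding Tb_def T_def less_succ_iff using F_le by meson

definition agree :: "'m \<Rightarrow> 'm \<Rightarrow> 'm \<Rightarrow> 'm \<Rightarrow> 'm \<Rightarrow> bool" where
  "agree m u x l t \<longleftrightarrow> (\<forall>k<l. \<forall>j<l. coded m t (cpair k j) = Tb u x k j)"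

lemma D2_agree: "polyn f \<Longrightarrow> polyn g \<Longrightarrow> polyn h \<Longrightarrow> polyn k \<Longrightarrow> polyn l \<Longrightarrow>
    D2 A (\<lambda>v. agree (f v) (g v) (h v) (k v) (l v))"
  unfolding agree_def by (intro a.D2_intros D2_Bd[OF Bd_coded] D2_Tb polyn_cpair polyn_tail)

lemma agree_iff: "\<rho> l u \<Longrightarrow> agree m u x l t \<longleftrightarrow> (\<forall>k<l. \<forall>j<l. coded m t (cpair k j) = T x k j)"
  unfolding agree_def using Tb_iff_T rho_mono by (metis order_less_imp_le order_refl)

context
  fixes X :: "'m \<Rightarrow> bool"
  assumes X: "D2 S (\<lambda>v. X (v 0))"
    and det: "\<And>x y. X x \<Longrightarrow> \<not> X y \<Longrightarrow> \<exists>k j. I k \<and> I j \<and> T x k j \<noteq> T y k j"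
begin

lemmas D2_X = D2_sub1[OF X]

text \<open>The bits of the types of all numbers below \<open>a\<close> are first coded by a single
  \<open>W\<close>. If no \<open>l\<close> in \<open>I\<close> sufficed, the bounded search
  \<open>L\<close> for a pair that \<open>W\<close> does not distinguish below \<open>l\<close>
  would succeed on \<open>I\<close>, hence by overspill for some \<open>l\<close> outside; that pair
  would have equal types, against \<open>det\<close>.\<close>

lemma types_differ:
  "\<exists>l. I l \<and> (\<forall>x<a. \<forall>y<a. X x \<longrightarrow> \<not> X y \<longrightarrow> (\<exists>k<l. \<exists>j<l. T x k j \<noteq> T y k j))"
proof (rule ccontr)
  assume neg: "\<not> ?thesis"
  \<comment> \<open>Covers all triples \<open>(x, k, j)\<close> with \<open>x < a\<close> and
    \<open>k\<close>, \<open>j\<close> in the cut, which lies below \<open>b\<close>.\<close>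
  let ?B = "cpair a (cpair b b) + 1"
  obtain m N where mN: "code_bound ?B m N" using s.code_bound_exists by blast
  \<comment> \<open>A stage \<open>u\<close> certifies that \<open>k\<close> and \<open>j\<close>
    lie in \<open>I\<close> and decides the bit, so that being true and being false are both
    \<Sigma>2 conditions.\<close>
  define Q0 where "Q0 z \<longleftrightarrow> (\<exists>x k j u. z = cpair x (cpair k j) \<and> \<rho> k u \<and> \<rho> j u \<and> Tb u x k j)" for z
  define Q1 where "Q1 z \<longleftrightarrow> (\<exists>x k j u. z = cpair x (cpair k j) \<and> \<rho> k u \<and> \<rho> j u \<and> \<not> Tb u x k j)" for z
  have "Sg S 2 (\<lambda>v. Q0 (v 0))" "Sg S 2 (\<lambda>v. Q1 (v 0))"
    unfolding Q0_def Q1_def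
    by (intro s.Sg2_ex D2_Sg D2_A_S a.D2_intros D2_rho D2_Tb polyn_cpair)+
  moreover have "False" if "Q0 z" "Q1 z" for z
    using that Tb_iff_T unfolding Q0_def Q1_def by auto
  ultimately obtain W where W: "\<And>z. z < ?B \<Longrightarrow> Q0 z \<Longrightarrow> coded m W z"
      "\<And>z. z < ?B \<Longrightarrow> Q1 z \<Longrightarrow> \<not> coded m W z"
    using s.separation[OF mN, of Q0 Q1] by blast
  have WT: "coded m W (cpair x (cpair k j)) = T x k j" if *: "x < a" "I k" "I j" for x k j
  proof -
    have "cpair x (cpair k j) < ?B"
      unfolding less_succ_iff using * I_less[OF _ not_I] by (intro cpair_mono order_less_imp_le) auto
    moreover obtain u where "\<rho> k u" "\<rho> j u" using I_bound * by blast
    ultimately show ?thesis using W Tb_iff_T unfolding Q0_def Q1_def by blast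
  qed
  define L where "L l \<longleftrightarrow> (\<exists>x<a. \<exists>y<a. X x \<and> \<not> X y \<and>
    (\<forall>k<l. \<forall>j<l. coded m W (cpair x (cpair k j)) = coded m W (cpair y (cpair k j))))" for l
  have "D2 S (\<lambda>v. L (v 0))"
    unfolding L_def by (intro s.D2_intros D2_X D2_Bd[OF Bd_coded] polyn_cpair)
  moreover have IL: "L l" if l: "I l" for l
  proof -
    obtain x y where xy: "x < a" "y < a" "X x" "\<not> X y" "\<And>k j. k < l \<Longrightarrow> j < l \<Longrightarrow> T x k j = T y k j"
      using neg l by blast
    have Ik: "I k" if "k < l" for k using I_down[OF \<open>I l\<close>] that by simp
    have "coded m W (cpair x (cpair k j)) = coded m W (cpair y (cpair k j))" if "k < l" "j < l" for k j
      using WT[OF xy(1) Ik Ik] WT[OF xy(2) Ik Ik] xy(5) that by simp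
    with xy(1-4) show ?thesis unfolding L_def by blast
  qed
  ultimately obtain l where "L l" "\<not> I l" using I_not_D2[of L] by blast
  then obtain x y where xy: "x < a" "y < a" "X x" "\<not> X y" and
    eq: "\<And>k j. k < l \<Longrightarrow> j < l \<Longrightarrow> coded m W (cpair x (cpair k j)) = coded m W (cpair y (cpair k j))"
    unfolding L_def by blast
  have "T x k j = T y k j" if "I k" "I j" for k j
    using eq[of k j] WT[OF xy(1) that] WT[OF xy(2) that] I_less[OF _ \<open>\<not> I l\<close>] that by blast
  then show False using det[OF xy(3,4)] by blast
qed

text \<open>\<open>E\<close> is found inside \<open>S\<close> but is a number, hence an admissible
  parameter: \<open>R\<close> replaces the reference to \<open>X\<close> by a lookup in
  \<open>E\<close>, and so is \<Sigma>2 in \<open>A\<close>.\<close>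

lemma Sg_A: "Sg A 2 (\<lambda>v. X (v 0))"
proof -
  \<comment> \<open>\<open>N\<close> bounds the codes of cut-off types, whose bits are indexed by
    pairs of numbers up to \<open>b\<close>.\<close>
  obtain m N where mN: "code_bound (cpair b b + 1) m N" using a.code_bound_exists by blast
  let ?B = "cpair b (cpair b N) + 1"
  obtain m' N' where mN': "code_bound ?B m' N'" using s.code_bound_exists by blast
  define Q0 where "Q0 z \<longleftrightarrow> (\<exists>i l t u w. z = cpair i (cpair l t) \<and> \<rho> l u \<and> F i w \<and>
     (\<exists>x<w. \<not> X x \<and> agree m u x l t))" for z
  define Q1 where "Q1 z \<longleftrightarrow> (\<exists>i l t u w. z = cpair i (cpair l t) \<and> \<rho> l u \<and> F i w \<and>
     \<not> (\<exists>x<w. \<not> X x \<and> agree m u x l t))" for z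
  have "Sg S 2 (\<lambda>v. Q0 (v 0))" "Sg S 2 (\<lambda>v. Q1 (v 0))"
    unfolding Q0_def Q1_def
    by (intro s.Sg2_ex D2_Sg s.D2_intros D2_A_S[OF D2_F] D2_A_S[OF D2_rho] D2_A_S[OF D2_agree] D2_X polyn_cpair)+
  moreover have "False" if "Q0 z" "Q1 z" for z
  proof -
    obtain i l t u w where 0: "z = cpair i (cpair l t)" "\<rho> l u" "F i w" "\<exists>x<w. \<not> X x \<and> agree m u x l t"
      using \<open>Q0 z\<close> unfolding Q0_def by blast
    obtain u' w' where 1: "\<rho> l u'" "F i w'" "\<not> (\<exists>x<w'. \<not> X x \<and> agree m u' x l t)"
      using \<open>Q1 z\<close> 0(1) unfolding Q1_def by auto
    show False using 0(4) 1(3) F_unique[OF 0(3) 1(2)] agree_iff[OF 0(2)] agree_iff[OF 1(1)] by blast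
  qed
  ultimately obtain E where E: "\<And>z. z < ?B \<Longrightarrow> Q0 z \<Longrightarrow> coded m' E z"
      "\<And>z. z < ?B \<Longrightarrow> Q1 z \<Longrightarrow> \<not> coded m' E z"
    using s.separation[OF mN', of Q0 Q1] by blast
  \<comment> \<open>Some cut-off type of \<open>x\<close> is not listed among those of the
    non-members below the same value of \<open>F\<close>. A non-member never satisfies this, since
    its own type is listed.\<close>
  define R where "R x \<longleftrightarrow> (\<exists>i l t u w. \<rho> l u \<and> F i w \<and> x < w \<and> t < N + 1 \<and> agree m u x l t \<and>
    \<not> coded m' E (cpair i (cpair l t)))" for x
  have B: "cpair i (cpair l t) < ?B" if "F i w" "\<rho> l u" "t < N + 1" for i l t u w
  proof -
    have "I i" "I l" using that unfolding F_def I_iff by blast+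
    then have "i \<le> b" "l \<le> b" using I_less[OF _ not_I] order_less_imp_le by blast+
    then show ?thesis using that(3) unfolding less_succ_iff by (intro cpair_mono)
  qed
  have "X x = R x" for x
  proof
    assume "X x"
    obtain i w where i: "F i w" "x < w"
      using cofinal[of x] F_exists F_def rho_mono by (meson not_less order_refl)
    obtain l where l: "I l" "\<And>x y. x < w \<Longrightarrow> y < w \<Longrightarrow> X x \<Longrightarrow> \<not> X y \<Longrightarrow> \<exists>k<l. \<exists>j<l. T x k j \<noteq> T y k j"
      using types_differ[of w] by blast
    obtain u where u: "\<rho> l u" using l(1) I_iff by blast
    have "D2 A (\<lambda>v. \<exists>k<v 0+1. \<exists>j<v 0+1. v 0 = cpair k j \<and> Tb u x k j)"
      by (intro a.D2_intros D2_Tb polyn_cpair)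
    from a.coding[OF mN this] obtain t where t: "t \<le> N"
      "\<And>z. z < cpair b b + 1 \<Longrightarrow> coded m t z = (\<exists>k<z+1. \<exists>j<z+1. z = cpair k j \<and> Tb u x k j)" by blast
    have "coded m t (cpair k j) = Tb u x k j" if "k < l" "j < l" for k j
    proof -
      have "k \<le> b" "j \<le> b" using that I_less[OF l(1) not_I] by auto
      then have "cpair k j < cpair b b + 1" unfolding less_succ_iff by (rule cpair_mono)
      from t(2)[OF this] show ?thesis
        by (auto simp: less_succ_iff le_cpair)
    qed
    then have ag: "agree m u x l t" unfolding agree_def by blast
    have "\<not> coded m' E (cpair i (cpair l t))"
    proof
      assume c: "coded m' E (cpair i (cpair l t))"
      have "cpair i (cpair l t) < ?B" using B[OF i(1) u] t(1) less_succ_iff by blast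
      with E(2) c have "\<not> Q1 (cpair i (cpair l t))" by blast
      then obtain y where y: "y < w" "\<not> X y" "agree m u y l t"
        unfolding Q1_def using i(1) u by blast
      with ag have "T x k j = T y k j" if "k < l" "j < l" for k j
        using that unfolding agree_iff[OF u] by blast
      with l(2)[OF i(2) y(1) \<open>X x\<close> y(2)] show False by blast
    qed
    with i u t(1) ag show "R x" unfolding R_def less_succ_iff by blast
  next
    assume "R x"
    then obtain i l t u w where *: "\<rho> l u" "F i w" "x < w" "t < N + 1" "agree m u x l t"
      "\<not> coded m' E (cpair i (cpair l t))"
      unfolding R_def by blast
    then have "\<not> Q0 (cpair i (cpair l t))" using E(1) B by blast
    with * show "X x" unfolding Q0_def by blast
  qed
  moreover have "Sg A 2 (\<lambda>v. R (v 0))"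
    unfolding R_def
    by (intro a.Sg2_ex D2_Sg a.D2_intros D2_F D2_rho D2_agree D2_Bd[OF Bd_coded] polyn_cpair)
  ultimately show ?thesis by simp
qed

end

text \<open>By \<open>X_iff\<close> membership depends on the type only, so numbers on different
  sides of \<open>X\<close> have different types. This is symmetric, and \<open>Sg_A\<close> applies
  to \<open>X\<close> and to its complement.\<close>

lemma D2_transfer:
  assumes X: "D2 S (\<lambda>v. X (v 0))" and iff: "\<And>x. X x \<longleftrightarrow> (\<exists>y. \<forall>z. \<theta> x y z)"
  shows "D2 A (\<lambda>v. X (v 0))"
proof -
  have X_iff: "X x \<longleftrightarrow> (\<exists>k. I k \<and> (\<forall>j. I j \<longrightarrow> T x k j))" for x
  proof
    assume "X x"
    then obtain y where y: "\<And>z. \<theta> x y z" using iff by blast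
    obtain k p where k: "I k" "F k p" "y < p"
      using cofinal[of y] F_exists F_def rho_mono by (meson not_less order_refl)
    then have "T x k j" if "I j" for j
      using F_exists[OF that] y unfolding T_def by blast
    with k(1) show "\<exists>k. I k \<and> (\<forall>j. I j \<longrightarrow> T x k j)" by blast
  next
    assume "\<exists>k. I k \<and> (\<forall>j. I j \<longrightarrow> T x k j)"
    then obtain k where k: "I k" "\<And>j. I j \<Longrightarrow> T x k j" by blast
    obtain p where p: "F k p" using F_exists[OF k(1)] by blast
    show "X x"
    proof (rule ccontr)
      assume "\<not> X x"
      then have "\<And>y. y < p \<Longrightarrow> \<exists>z. \<not> \<theta> x y z" using iff by blast
      moreover have "Sg A 2 (\<lambda>v. \<not> \<theta> x (v 0) (v 1))"
        by (intro D2_Sg a.D2_intros D2_theta)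
      \<comment> \<open>Collection bounds the counterexamples for all \<open>y < p\<close> at once,
        so that some value of \<open>F\<close> exceeds them all.\<close>
      ultimately have "\<exists>c. \<forall>y<p. \<exists>z<c. \<not> \<theta> x y z" by (intro a.collection)
      then obtain c where c: "\<And>y. y < p \<Longrightarrow> \<exists>z<c. \<not> \<theta> x y z" by blast
      obtain j q where j: "I j" "F j q" "c < q"
        using cofinal[of c] F_exists F_def rho_mono by (meson not_less order_refl)
      from k(2)[OF j(1)] obtain y where "y < p" "\<And>z. z < q \<Longrightarrow> \<theta> x y z"
        unfolding T_def using F_unique[OF p] F_unique[OF j(2)] by blast
      with c[of y] j(3) show False by (meson order_less_trans)
    qed
  qed
  have "Sg A 2 (\<lambda>v. X (v 0))"
    using Sg_A[OF X] X_iff by metis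
  moreover have "Sg A 2 (\<lambda>v. \<not> X (v 0))"
    using Sg_A[OF D2_neg[OF X]] X_iff by metis
  ultimately show ?thesis unfolding D2_def Pi_iff_Sg by blast
qed

end

section \<open>The recursion equation of the universal function\<close>

lemma entry_unique: "entry s i r \<Longrightarrow> entry s i r' \<Longrightarrow> r = r'"
  unfolding entry_def using div_unique by (metis cpair_inj)

lemma entry_le: "entry s i r \<Longrightarrow> r \<le> s"
proof -
  assume "entry s i r"
  then obtain a b q where "s = cpair a b" "a = q * (1 + (i + 1) * b) + r" unfolding entry_def by blast
  then have "r \<le> a" "a \<le> s" using le_cpair by (auto simp: add_increasing)
  then show ?thesis by simp
qed

lemma Bd_entry: "polyn f \<Longrightarrow> polyn g \<Longrightarrow> polyn h \<Longrightarrow> Bd S (\<lambda>v. entry (f v) (g v) (h v))"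
proof -
  have "entry s i r \<longleftrightarrow> (\<exists>a<s+1. \<exists>b<s+1. \<exists>q<s+1. s = cpair a b \<and> a = q * (1 + (i + 1) * b) + r \<and> r < 1 + (i + 1) * b)"
    for s i r :: 'a
  proof -
    have "a < s + 1 \<and> b < s + 1 \<and> q < s + 1" if s: "s = cpair a b" "a = q * (1 + (i + 1) * b) + r" for a b q
    proof -
      have "q * 1 \<le> q * (1 + (i + 1) * b)" by (intro mult_left_mono) auto
      also have "\<dots> \<le> a" using s by simp
      finally have "q \<le> s" using le_cpair(1)[of a b] s(1) by auto
      then show ?thesis unfolding less_succ_iff using s(1) le_cpair by auto
    qed
    then show ?thesis unfolding entry_def by blast
  qed
  then show "polyn f \<Longrightarrow> polyn g \<Longrightarrow> polyn h \<Longrightarrow> Bd S (\<lambda>v. entry (f v) (g v) (h v))"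
    by simp (intro Bd_intros polyn_cpair polyn_tail)
qed

lemma recorded_le: "recorded d i e x y \<Longrightarrow> e \<le> d \<and> x \<le> d \<and> y \<le> d"
  unfolding recorded_def by (drule entry_le) (meson le_cpair order_trans)

lemma recorded_unique: "recorded d i e x y \<Longrightarrow> recorded d i e' x' y' \<Longrightarrow> e = e' \<and> x = x' \<and> y = y'"
  unfolding recorded_def by (drule (1) entry_unique) simp

definition before :: "'m::pa_minus \<Rightarrow> 'm \<Rightarrow> 'm \<Rightarrow> 'm \<Rightarrow> 'm \<Rightarrow> bool" where
  "before d i e x y \<longleftrightarrow> (\<exists>j<i. recorded d j e x y)"

lemma Bd_recorded: "polyn d \<Longrightarrow> polyn i \<Longrightarrow> polyn e \<Longrightarrow> polyn x \<Longrightarrow> polyn y \<Longrightarrow>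
    Bd S (\<lambda>v. recorded (d v) (i v) (e v) (x v) (y v))"
  unfolding recorded_def by (intro Bd_entry polyn_cpair)

lemma Bd_before: "polyn d \<Longrightarrow> polyn i \<Longrightarrow> polyn e \<Longrightarrow> polyn x \<Longrightarrow> polyn y \<Longrightarrow>
    Bd S (\<lambda>v. before (d v) (i v) (e v) (x v) (y v))"
  unfolding before_def by (intro Bd_intros Bd_recorded polyn_tail)

text \<open>The numbers recorded in a sequence, and their components, are at most its code
  \<open>d\<close>, so \<open>d + 1\<close> serves as bound throughout. \<open>of_bool\<close> is
  spelt out because it is not a polynomial.\<close>

definition bounded_justified :: "'m::pa_minus \<Rightarrow> 'm \<Rightarrow> 'm set \<Rightarrow> 'm \<Rightarrow> 'm \<Rightarrow> 'm \<Rightarrow> bool" where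
  "bounded_justified d i A e x y \<longleftrightarrow>
      e = cpair 0 y
    \<or> e = cpair 1 0 \<and> y = x
    \<or> e = cpair 1 1 \<and> (\<exists>z<d+1. x = cpair y z)
    \<or> e = cpair 1 2 \<and> (\<exists>z<d+1. x = cpair z y)
    \<or> e = cpair 1 3 \<and> (\<exists>a<d+1. \<exists>b<d+1. x = cpair a b \<and> y = a + b)
    \<or> e = cpair 1 4 \<and> (\<exists>a<d+1. \<exists>b<d+1. x = cpair a b \<and> y = a * b)
    \<or> e = cpair 1 5 \<and> (\<exists>a<d+1. \<exists>b<d+1. x = cpair a b \<and> (a < b \<and> y = 1 \<or> \<not> a < b \<and> y = 0))
    \<or> e = cpair 1 6 \<and> (x \<in> A \<and> y = 1 \<or> x \<notin> A \<and> y = 0)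
    \<or> (\<exists>f<d+1. \<exists>g<d+1. \<exists>a<d+1. \<exists>b<d+1. e = cpair 2 (cpair f g) \<and> before d i f x a \<and> before d i g x b \<and> y = cpair a b)
    \<or> (\<exists>f<d+1. \<exists>g<d+1. \<exists>z<d+1. e = cpair 3 (cpair f g) \<and> before d i g x z \<and> before d i f z y)
    \<or> (\<exists>f<d+1. e = cpair 4 f \<and> before d i f (cpair x y) 0 \<and> (\<forall>z<y. \<exists>w<d+1. w \<noteq> 0 \<and> before d i f (cpair x z) w))"

lemma Bd_bounded_justified: "polyn d \<Longrightarrow> polyn i \<Longrightarrow> polyn e \<Longrightarrow> polyn x \<Longrightarrow> polyn y \<Longrightarrow>
    Bd S (\<lambda>v. bounded_justified (d v) (i v) (S k) (e v) (x v) (y v))"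
  unfolding bounded_justified_def by (intro Bd_intros Bd_before polyn_cpair polyn_tail)

lemma justified_iff_bounded:
  assumes "x \<le> d"
  shows "justified A (before d i) e x y \<longleftrightarrow> bounded_justified d i A e x y"
proof -
  have le: "e \<le> d" "x \<le> d" "y \<le> d" if "before d i e x y" for e x y
    using that recorded_le unfolding before_def by blast+
  have x: "a \<le> d \<and> b \<le> d" if "x = cpair a b" for a b
    using assms le_cpair that by (meson order_trans)
  have of_bool_iff: "y = of_bool P \<longleftrightarrow> P \<and> y = 1 \<or> \<not> P \<and> y = 0" for P
    by auto
  have proj: "(\<exists>z. x = cpair y z) = (\<exists>z\<le>d. x = cpair y z)" "(\<exists>z. x = cpair z y) = (\<exists>z\<le>d. x = cpair z y)"
    using x by blast+
  have op: "(\<exists>a b. x = cpair a b \<and> P a b) = (\<exists>a\<le>d. \<exists>b\<le>d. x = cpair a b \<and> P a b)" for P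
    using x by blast
  have pair: "(\<exists>f g a b. e = cpair 2 (cpair f g) \<and> before d i f x a \<and> before d i g x b \<and> y = cpair a b) =
    (\<exists>f\<le>d. \<exists>g\<le>d. \<exists>a\<le>d. \<exists>b\<le>d. e = cpair 2 (cpair f g) \<and> before d i f x a \<and> before d i g x b \<and> y = cpair a b)"
    using le(1)[of _ x] le(3)[of _ x] by blast
  have comp: "(\<exists>f g z. e = cpair 3 (cpair f g) \<and> before d i g x z \<and> before d i f z y) =
    (\<exists>f\<le>d. \<exists>g\<le>d. \<exists>z\<le>d. e = cpair 3 (cpair f g) \<and> before d i g x z \<and> before d i f z y)"
    using le(1)[of _ x] le(3)[of _ x] le(1)[of _ _ y] by blast
  have search: "(\<exists>w. w \<noteq> 0 \<and> before d i f u w) = (\<exists>w\<le>d. w \<noteq> 0 \<and> before d i f u w)" for f u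
    using le(3)[of f u] by blast
  have search': "(\<exists>f. e = cpair 4 f \<and> before d i f (cpair x y) 0 \<and> P f) =
    (\<exists>f\<le>d. e = cpair 4 f \<and> before d i f (cpair x y) 0 \<and> P f)" for P
    using le(1)[of _ "cpair x y"] by blast
  show ?thesis
    unfolding justified_def bounded_justified_def less_succ_iff of_bool_iff
    by (simp only: proj op pair comp search search')
qed

lemma computation_iff_bounded:
  "computation A d n \<longleftrightarrow> (\<forall>i<n. \<exists>e<d+1. \<exists>x<d+1. \<exists>y<d+1. recorded d i e x y \<and> bounded_justified d i A e x y)"
proof -
  have "(\<lambda>e' x' y'. \<exists>j<i. recorded d j e' x' y') = before d i" for i
    by (simp add: before_def fun_eq_iff)
  then show ?thesis
    unfolding computation_def less_succ_iff by (simp only:) (meson recorded_le justified_iff_bounded)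
qed

lemma Bd_computation: "polyn f \<Longrightarrow> polyn g \<Longrightarrow> Bd S (\<lambda>v. computation (S k) (f v) (g v))"
  unfolding computation_iff_bounded
  by (intro Bd_intros Bd_recorded Bd_bounded_justified polyn_tail)

section \<open>Stages of the universal function\<close>

lemma justified_mono:
  assumes "justified A D e x y" "\<And>e x y. D e x y \<Longrightarrow> D' e x y"
  shows "justified A D' e x y"
  using assms(1) unfolding justified_def
  by (elim disj_forward) (blast intro: assms(2))+

lemma Phi_justified: "Phi A e x y \<Longrightarrow> justified A (Phi A) e x y"
proof -
  assume "Phi A e x y"
  then obtain d n i where *: "computation A d n" "i < n" "recorded d i e x y" unfolding Phi_def by blast
  then obtain e' x' y' where "recorded d i e' x' y'"
    and "justified A (\<lambda>e' x' y'. \<exists>j<i. recorded d j e' x' y') e' x' y'"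
    unfolding computation_def by blast
  moreover from this(1) * have "e' = e \<and> x' = x \<and> y' = y" using recorded_unique by blast
  ultimately have "justified A (\<lambda>e' x' y'. \<exists>j<i. recorded d j e' x' y') e x y" by simp
  then show ?thesis
  proof (rule justified_mono)
    fix e x y assume "\<exists>j<i. recorded d j e x y"
    with * show "Phi A e x y" unfolding Phi_def by (meson order_less_trans)
  qed
qed

text \<open>Stage \<open>b\<close> of the enumeration of \<open>Phi\<close>; one bound for code and
  length makes it a bounded predicate, monotone in \<open>b\<close>.\<close>

definition Phi_below :: "'m::pa_minus set \<Rightarrow> 'm \<Rightarrow> 'm \<Rightarrow> 'm \<Rightarrow> 'm \<Rightarrow> bool" where
  "Phi_below A b e x y \<longleftrightarrow> (\<exists>d<b. \<exists>n<b. computation A d n \<and> before d n e x y)"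

lemma Phi_iff_below: "Phi A e x y \<longleftrightarrow> (\<exists>b. Phi_below A b e x y)"
  unfolding Phi_def Phi_below_def before_def using bounded_ex_two[of "\<lambda>d n. computation A d n \<and> (\<exists>i<n. recorded d i e x y)"]
  by blast

lemma Phi_below_mono: "Phi_below A b e x y \<Longrightarrow> b \<le> c \<Longrightarrow> Phi_below A c e x y"
  unfolding Phi_below_def by (meson order_less_le_trans)

lemma justified_split:
  "justified A D e x y \<longleftrightarrow> justified A (\<lambda>_ _ _. False) e x y
    \<or> (\<exists>f g a b. e = cpair 2 (cpair f g) \<and> D f x a \<and> D g x b \<and> y = cpair a b)
    \<or> (\<exists>f g z. e = cpair 3 (cpair f g) \<and> D g x z \<and> D f z y)
    \<or> (\<exists>f. e = cpair 4 f \<and> D f (cpair x y) 0 \<and> (\<forall>z<y. \<exists>w. w \<noteq> 0 \<and> D f (cpair x z) w))"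
  unfolding justified_def by (simp add: disj_assoc)

lemma justified_cases:
  assumes "justified A D e x y"
  obtains "\<And>D'. justified A D' e x y"
  | f g a b where "e = cpair 2 (cpair f g)" "D f x a" "D g x b" "y = cpair a b"
  | f g z where "e = cpair 3 (cpair f g)" "D g x z" "D f z y"
  | f where "e = cpair 4 f" "D f (cpair x y) 0" "\<And>z. z < y \<Longrightarrow> \<exists>w. w \<noteq> 0 \<and> D f (cpair x z) w"
proof -
  have "justified A D' e x y" if "justified A (\<lambda>_ _ _. False) e x y" for D'
    using that by (rule justified_mono) simp
  with assms[unfolded justified_split[of A D]] show ?thesis
    using that by (elim disjE exE conjE) blast+
qed

context bs2
begin

text \<open>Pairing and composition consult two computations, for which a maximum is enough.
  Minimization consults one for each \<open>z < y\<close>; these are bounded together by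
  collection.\<close>

lemma justified_Phi_below:
  assumes "justified (S k) (Phi (S k)) e x y" shows "\<exists>b. justified (S k) (Phi_below (S k) b) e x y"
  using assms
proof (cases rule: justified_cases)
  case (2 f g a c)
  then obtain b b' where "Phi_below (S k) b f x a" "Phi_below (S k) b' g x c" unfolding Phi_iff_below by blast
  then have "Phi_below (S k) (max b b') f x a" "Phi_below (S k) (max b b') g x c"
    using Phi_below_mono by (meson max.cobounded1 max.cobounded2)+
  with 2 have "justified (S k) (Phi_below (S k) (max b b')) e x y" unfolding justified_def by blast
  then show ?thesis by blast
next
  case (3 f g z)
  then obtain b b' where "Phi_below (S k) b g x z" "Phi_below (S k) b' f z y" unfolding Phi_iff_below by blast
  then have "Phi_below (S k) (max b b') g x z" "Phi_below (S k) (max b b') f z y"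
    using Phi_below_mono by (meson max.cobounded1 max.cobounded2)+
  with 3 have "justified (S k) (Phi_below (S k) (max b b')) e x y" unfolding justified_def by blast
  then show ?thesis by blast
next
  case (4 f)
  obtain b where b: "Phi_below (S k) b f (cpair x y) 0" using 4(2) unfolding Phi_iff_below by blast
  have "Sg S 2 (\<lambda>v. \<exists>w. w \<noteq> 0 \<and> Phi_below (S k) (v 1) f (cpair x (v 0)) w)"
    unfolding Phi_below_def by (intro Sg2_ex Bd_Sg Bd_intros Bd_computation Bd_before polyn_cpair)
  moreover have "\<exists>b. \<exists>w. w \<noteq> 0 \<and> Phi_below (S k) b f (cpair x z) w" if "z < y" for z
    using 4(3)[OF that] unfolding Phi_iff_below by blast
  ultimately have "\<exists>c. \<forall>z<y. \<exists>b<c. \<exists>w. w \<noteq> 0 \<and> Phi_below (S k) b f (cpair x z) w"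
    by (intro collection)
  then obtain c where c: "\<And>z. z < y \<Longrightarrow> \<exists>b<c. \<exists>w. w \<noteq> 0 \<and> Phi_below (S k) b f (cpair x z) w" by blast
  have "Phi_below (S k) (max b c) f (cpair x y) 0" using b Phi_below_mono by (meson max.cobounded1)
  moreover have "\<exists>w. w \<noteq> 0 \<and> Phi_below (S k) (max b c) f (cpair x z) w" if "z < y" for z
    using c[OF that] Phi_below_mono by (meson max.cobounded2 order_less_imp_le order_trans)
  ultimately have "justified (S k) (Phi_below (S k) (max b c)) e x y" using 4(1) unfolding justified_def by blast
  then show ?thesis by blast
qed blast

text \<open>
  All computations below \<open>b\<close> are merged into one: the \<open>j\<close>-th record of the computation
  \<open>(d, n)\<close> gets the position \<open>cpair d (cpair n j)\<close>, and all other positions get the record \<open>0\<close>,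
  which is \<open>cpair (cpair 0 0) (cpair 0 0)\<close>.
\<close>

lemma justified_imp_Phi:
  assumes "justified (S k) (Phi (S k)) e x y" shows "Phi (S k) e x y"
proof -
  obtain b where b: "justified (S k) (Phi_below (S k) b) e x y" using justified_Phi_below[OF assms] by blast
  \<comment> \<open>\<open>M\<close> exceeds all positions of merged records and is itself the
    position of the new record \<open>r0\<close>.\<close>
  define M where "M = cpair b (cpair b b) + 1"
  define r0 where "r0 = cpair e (cpair x y)"
  define Q where "Q d n j i \<longleftrightarrow> i = cpair d (cpair n j) \<and> computation (S k) d n \<and> j < n" for d n j i
  define R where "R i r \<longleftrightarrow> i = M \<and> r = r0 \<or>
    i < M \<and> ((\<exists>d<b. \<exists>n<b. \<exists>j<b. Q d n j i \<and> entry d j r) \<or> \<not> (\<exists>d<b. \<exists>n<b. \<exists>j<b. Q d n j i) \<and> r = 0)" for i r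
  have ex: "\<exists>r. R i r" if "i < M + 1" for i
  proof (cases "\<exists>d<b. \<exists>n<b. \<exists>j<b. Q d n j i")
    case True
    then obtain d n j where *: "d < b" "n < b" "j < b" "Q d n j i" by blast
    then obtain r where "entry d j r" unfolding Q_def computation_def recorded_def by blast
    with * that show ?thesis unfolding R_def less_succ_iff by (metis order_le_less)
  next
    case False
    with that show ?thesis unfolding R_def less_succ_iff by (metis order_le_less)
  qed
  have un: "r = r'" if "R i r" "R i r'" for i r r'
    using that unfolding R_def Q_def by (auto dest: entry_unique)
  have bd: "r < b + r0 + 1" if "R i r" for i r
  proof -
    have "r \<le> b \<or> r \<le> r0" using that unfolding R_def by (meson entry_le order_less_imp_le order_le_less_trans order_refl zero_le)
    then show ?thesis unfolding less_succ_iff by (auto intro: add_increasing add_increasing2)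
  qed
  have "Sg S 1 (\<lambda>v. R (v 0) (v 1))"
    unfolding R_def Q_def by (intro Bd_Sg Bd_intros Bd_entry Bd_computation polyn_cpair)
  from beta[OF this, of "M + 1" "b + r0 + 1"] ex un bd obtain s where s: "\<And>i r. i < M + 1 \<Longrightarrow> entry s i r = R i r" by blast
  have R_in: "cpair d (cpair n j) < M" "R (cpair d (cpair n j)) r"
    if *: "d < b" "n < b" "computation (S k) d n" "j < n" "entry d j r" for d n j r
  proof -
    have jb: "j < b" using * by simp
    show 1: "cpair d (cpair n j) < M"
      unfolding M_def less_succ_iff using * jb by (intro cpair_mono) auto
    have "Q d n j (cpair d (cpair n j))" unfolding Q_def using * by simp
    then have "\<exists>d'<b. \<exists>n'<b. \<exists>j'<b. Q d' n' j' (cpair d (cpair n j)) \<and> entry d' j' r"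
      using * jb by blast
    with 1 show "R (cpair d (cpair n j)) r" unfolding R_def by (intro disjI2 conjI disjI1)
  qed
  have in_s: "\<exists>j<M. recorded s j e' x' y'" if below: "Phi_below (S k) b e' x' y'" for e' x' y'
  proof -
    obtain d n j where *: "d < b" "n < b" "computation (S k) d n" "j < n" "entry d j (cpair e' (cpair x' y'))"
      using below unfolding Phi_below_def before_def recorded_def by blast
    have "cpair d (cpair n j) < M + 1" using R_in(1)[OF *] less_succ[of M] by (rule order_less_trans)
    then have "recorded s (cpair d (cpair n j)) e' x' y'"
      unfolding recorded_def using s R_in(2)[OF *] by simp
    then show ?thesis using R_in(1)[OF *] by blast
  qed
  have "\<exists>e x y. recorded s i e x y \<and> justified (S k) (\<lambda>e' x' y'. \<exists>j<i. recorded s j e' x' y') e x y"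
    if i: "i < M + 1" for i
  proof -
    obtain r where r: "R i r" using ex[OF i] by blast
    then consider "i = M" "r = r0" | "i < M" "\<exists>d<b. \<exists>n<b. \<exists>j<b. Q d n j i \<and> entry d j r" | "r = 0"
      unfolding R_def by blast
    then show ?thesis
    proof cases
      case 1
      then have "recorded s i e x y" using r s[OF i] unfolding recorded_def r0_def by blast
      moreover have "justified (S k) (\<lambda>e' x' y'. \<exists>j<i. recorded s j e' x' y') e x y"
        using justified_mono[OF b in_s] 1 by simp
      ultimately show ?thesis by blast
    next
      case 2
      then obtain d n j where *: "d < b" "n < b" "j < b" "i = cpair d (cpair n j)" "computation (S k) d n" "j < n" "entry d j r"
        unfolding Q_def by blast
      then obtain e' x' y' where rec: "recorded d j e' x' y'"
        and jus: "justified (S k) (\<lambda>e' x' y'. \<exists>l<j. recorded d l e' x' y') e' x' y'"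
        unfolding computation_def by blast
      have "recorded s i e' x' y'"
        using r s[OF i] rec entry_unique[OF *(7)] unfolding recorded_def by blast
      moreover have "justified (S k) (\<lambda>e' x' y'. \<exists>j<i. recorded s j e' x' y') e' x' y'"
      proof (rule justified_mono[OF jus])
        fix e x y assume "\<exists>l<j. recorded d l e x y"
        then obtain l where l: "l < j" "recorded d l e x y" by blast
        \<comment> \<open>Pairing is strictly increasing in its last argument, so merging preserves
          the order within one computation.\<close>
        then have li: "cpair d (cpair n l) < i" unfolding *(4) by (intro cpair_strict_mono)
        have "R (cpair d (cpair n l)) (cpair e (cpair x y))"
          using R_in(2)[OF *(1,2,5)] l *(6) unfolding recorded_def by (meson order_less_trans)
        moreover have "cpair d (cpair n l) < M + 1" using li i by simp
        ultimately show "\<exists>j<i. recorded s j e x y" using s li unfolding recorded_def by blast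
      qed
      ultimately show ?thesis by blast
    next
      case 3
      have "0 = cpair 0 (cpair 0 (0::'m))" by (simp add: cpair_def)
      then have "recorded s i 0 0 0" using 3 r s[OF i] unfolding recorded_def by simp
      moreover have "justified (S k) D 0 0 0" for D unfolding justified_def by (simp add: cpair_def)
      ultimately show ?thesis by blast
    qed
  qed
  then have "computation (S k) s (M + 1)" unfolding computation_def by blast
  moreover have "recorded s M e x y" using s[of M r0] less_succ unfolding recorded_def R_def r0_def by blast
  ultimately show ?thesis unfolding Phi_def using less_succ by blast
qed

lemma Phi_iff: "Phi (S k) e x y \<longleftrightarrow> justified (S k) (Phi (S k)) e x y"
  using Phi_justified justified_imp_Phi by blast

end

section \<open>Completeness of the jump\<close>

primrec tup :: "nat \<Rightarrow> (nat \<Rightarrow> 'm::pa_minus) \<Rightarrow> 'm" where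
  "tup 0 v = 0"
| "tup (Suc k) v = cpair (v 0) (tup k (\<lambda>i. v (Suc i)))"

lemma polyn_tup: "(\<And>i. polyn (\<lambda>v. f v i)) \<Longrightarrow> polyn (\<lambda>v. tup k (f v))"
  by (induction k arbitrary: f) (auto intro: polyn_const polyn_cpair)

lemma polyn_env: "polyn (\<lambda>v. env E v i)"
  by (cases "E i") (auto simp: env_def intro: polyn_intros)

lemma dfn_formula: "C \<phi> \<Longrightarrow> dfn S C (\<lambda>u. sat S (u 0 \<triangleright> v) \<phi>)"
proof -
  let ?E = "\<lambda>i. case i of 0 \<Rightarrow> Inl 0 | Suc j \<Rightarrow> Inr (v j)"
  have "env ?E u = u 0 \<triangleright> v" for u
    by (auto simp: env_def scons_def fun_eq_iff split: nat.split)
  moreover assume "C \<phi>"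
  ultimately show ?thesis using dfn_sat[of C \<phi> S ?E] by simp
qed

locale one_set = bs2 "\<lambda>_. A" for A :: "'m::pa_minus set"
begin

section \<open>Values of the indices, clause by clause\<close>

lemmas Phi_step = Phi_iff[simplified]

lemma Phi_const: "Phi A (cpair 0 c) x y \<longleftrightarrow> y = c"
  by (subst Phi_step) (auto simp: justified_def)

lemma Phi_fst: "Phi A (cpair 1 1) (cpair a b) y \<longleftrightarrow> y = a"
  by (subst Phi_step) (auto simp: justified_def)

lemma Phi_snd: "Phi A (cpair 1 2) (cpair a b) y \<longleftrightarrow> y = b"
  by (subst Phi_step) (auto simp: justified_def)

lemma Phi_add: "Phi A (cpair 1 3) (cpair a b) y \<longleftrightarrow> y = a + b"
  by (subst Phi_step) (auto simp: justified_def)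

lemma Phi_mult: "Phi A (cpair 1 4) (cpair a b) y \<longleftrightarrow> y = a * b"
  by (subst Phi_step) (auto simp: justified_def)

lemma Phi_less: "Phi A (cpair 1 5) (cpair a b) y \<longleftrightarrow> y = of_bool (a < b)"
  by (subst Phi_step) (auto simp: justified_def)

lemma Phi_oracle: "Phi A (cpair 1 6) x y \<longleftrightarrow> y = of_bool (x \<in> A)"
  by (subst Phi_step) (auto simp: justified_def)

lemma Phi_pair:
  "Phi A (cpair 2 (cpair f g)) x y \<longleftrightarrow> (\<exists>a b. Phi A f x a \<and> Phi A g x b \<and> y = cpair a b)"
  by (subst Phi_step) (auto simp: justified_def)

lemma Phi_comp: "Phi A (cpair 3 (cpair f g)) x y \<longleftrightarrow> (\<exists>z. Phi A g x z \<and> Phi A f z y)"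
  by (subst Phi_step) (auto simp: justified_def)

lemma Phi_min: "Phi A (cpair 4 f) x y \<longleftrightarrow>
    Phi A f (cpair x y) 0 \<and> (\<forall>z<y. \<exists>w. w \<noteq> 0 \<and> Phi A f (cpair x z) w)"
  by (subst Phi_step) (auto simp: justified_def)

section \<open>Total functions computable on tuples of standard length\<close>

definition computable :: "nat \<Rightarrow> ((nat \<Rightarrow> 'm) \<Rightarrow> 'm) \<Rightarrow> bool" where
  "computable k f \<longleftrightarrow> (\<exists>e. \<forall>v y. Phi A e (tup k v) y \<longleftrightarrow> y = f v)"

lemma computableI: "(\<And>v y. Phi A e (tup k v) y \<longleftrightarrow> y = f v) \<Longrightarrow> computable k f"
  unfolding computable_def by blast

lemma computable_const: "computable k (\<lambda>v. c)"
  by (rule computableI, rule Phi_const)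

lemma computable_pair:
  assumes "computable k f" "computable k g" shows "computable k (\<lambda>v. cpair (f v) (g v))"
proof -
  obtain e d where "\<And>v y. Phi A e (tup k v) y \<longleftrightarrow> y = f v" "\<And>v y. Phi A d (tup k v) y \<longleftrightarrow> y = g v"
    using assms unfolding computable_def by blast
  then show ?thesis by (intro computableI[where e = "cpair 2 (cpair e d)"]) (simp add: Phi_pair)
qed

lemma computable_comp:
  assumes "computable k f" "\<And>v y. Phi A d (f v) y \<longleftrightarrow> y = g v" shows "computable k g"
proof -
  obtain e where "\<And>v y. Phi A e (tup k v) y \<longleftrightarrow> y = f v"
    using assms unfolding computable_def by blast
  with assms(2) show ?thesis by (intro computableI[where e = "cpair 3 (cpair d e)"]) (simp add: Phi_comp)
qed

lemma computable_add: "computable k f \<Longrightarrow> computable k g \<Longrightarrow> computable k (\<lambda>v. f v + g v)"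
  by (rule computable_comp[OF computable_pair Phi_add])

lemma computable_mult: "computable k f \<Longrightarrow> computable k g \<Longrightarrow> computable k (\<lambda>v. f v * g v)"
  by (rule computable_comp[OF computable_pair Phi_mult])

lemma computable_less: "computable k f \<Longrightarrow> computable k g \<Longrightarrow> computable k (\<lambda>v. of_bool (f v < g v))"
  by (rule computable_comp[OF computable_pair Phi_less])

lemma computable_oracle: "computable k f \<Longrightarrow> computable k (\<lambda>v. of_bool (f v \<in> A))"
  by (rule computable_comp[OF _ Phi_oracle])

lemma computable_neg: "computable k (\<lambda>v. of_bool (P v)) \<Longrightarrow> computable k (\<lambda>v. of_bool (\<not> P v))"
proof -
  have "of_bool (of_bool b < (1 :: 'm)) = (of_bool (\<not> b) :: 'm)" for b by (cases b) auto
  then show "computable k (\<lambda>v. of_bool (P v)) \<Longrightarrow> computable k (\<lambda>v. of_bool (\<not> P v))"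
    using computable_less[of k "\<lambda>v. of_bool (P v)" "\<lambda>v. 1"] computable_const[of k 1] by simp
qed

lemma computable_conj: "computable k (\<lambda>v. of_bool (P v)) \<Longrightarrow> computable k (\<lambda>v. of_bool (Q v)) \<Longrightarrow>
    computable k (\<lambda>v. of_bool (P v \<and> Q v))"
  using computable_mult[of k "\<lambda>v. of_bool (P v)" "\<lambda>v. of_bool (Q v)"] by (simp flip: of_bool_conj)

lemma computable_tail:
  assumes "computable k f" shows "computable (Suc k) (\<lambda>v. f (\<lambda>i. v (Suc i)))"
proof -
  obtain e where "\<And>v y. Phi A e (tup k v) y \<longleftrightarrow> y = f v"
    using assms unfolding computable_def by blast
  then show ?thesis by (intro computableI[where e = "cpair 3 (cpair e (cpair 1 2))"]) (simp add: Phi_comp Phi_snd)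
qed

lemma computable_var: "i < k \<Longrightarrow> computable k (\<lambda>v. v i)"
proof (induction i arbitrary: k)
  case 0
  then show ?case by (cases k) (auto intro!: computableI[where e = "cpair 1 1"] simp: Phi_fst)
next
  case (Suc i)
  then show ?case using computable_tail[of _ "\<lambda>v. v i"] by (cases k) auto
qed

lemma computable_search:
  assumes "computable (Suc k) f"
  shows "\<exists>e. \<forall>v y. Phi A e (tup k v) y \<longleftrightarrow> f (y \<triangleright> v) = 0 \<and> (\<forall>z<y. f (z \<triangleright> v) \<noteq> 0)"
proof -
  obtain e where e: "\<And>v y. Phi A e (tup (Suc k) v) y \<longleftrightarrow> y = f v"
    using assms unfolding computable_def by blast
  \<comment> \<open>Minimization appends the searched value to the argument, while tuples are
    extended in front; \<open>d\<close> swaps the two before applying \<open>e\<close>.\<close>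
  define d where "d = cpair 3 (cpair e (cpair 2 (cpair (cpair 1 2) (cpair 1 1))))"
  have "Phi A d (cpair (tup k v) z) y \<longleftrightarrow> y = f (z \<triangleright> v)" for v z y
    using e[of "z \<triangleright> v" y] by (simp add: d_def Phi_comp Phi_pair Phi_fst Phi_snd)
  then have "Phi A (cpair 4 d) (tup k v) y \<longleftrightarrow> f (y \<triangleright> v) = 0 \<and> (\<forall>z<y. f (z \<triangleright> v) \<noteq> 0)" for v y
    by (auto simp: Phi_min)
  then show ?thesis by blast
qed

text \<open>\<open>K\<close> is taken above the indices of the variables of \<open>t\<close>,
  because a tuple of length \<open>k\<close> records only the first \<open>k\<close>
  variables.\<close>

lemma computable_val: "\<exists>K. \<forall>k\<ge>K. computable k (\<lambda>v. val v t)"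
proof (induction t)
  case (Var i)
  then show ?case using computable_var by (auto intro!: exI[of _ "Suc i"])
next
  case (Add s t)
  then obtain K L where "\<And>k. k \<ge> K \<Longrightarrow> computable k (\<lambda>v. val v s)" "\<And>k. k \<ge> L \<Longrightarrow> computable k (\<lambda>v. val v t)" by blast
  then show ?case by (intro exI[of _ "max K L"]) (auto intro: computable_add)
next
  case (Mul s t)
  then obtain K L where "\<And>k. k \<ge> K \<Longrightarrow> computable k (\<lambda>v. val v s)" "\<And>k. k \<ge> L \<Longrightarrow> computable k (\<lambda>v. val v t)" by blast
  then show ?case by (intro exI[of _ "max K L"]) (auto intro: computable_mult)
qed (auto intro: computable_const)

abbreviation "computes k \<phi> \<equiv> computable k (\<lambda>v. of_bool (sat (\<lambda>_. A) v \<phi>))"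

lemma least_dfn:
  assumes "bounded_fm \<phi>" "sat (\<lambda>_. A) (x \<triangleright> v) \<phi>"
  obtains y where "sat (\<lambda>_. A) (y \<triangleright> v) \<phi>" "\<And>z. z < y \<Longrightarrow> \<not> sat (\<lambda>_. A) (z \<triangleright> v) \<phi>"
  using least_D2[of "\<lambda>y. sat (\<lambda>_. A) (y \<triangleright> v) \<phi>" x] D2_Bd dfn_formula[of bounded_fm \<phi>] assms by blast

text \<open>The search for the first \<open>y\<close> that violates
  \<open>y < val v t \<and> \<phi>\<close> halts at the bound at the latest; the universal statement
  holds iff it does not halt earlier.\<close>

lemma computes_BForall:
  assumes b: "bounded_fm \<phi>" and \<phi>: "computes (Suc k) \<phi>" and t: "computable k (\<lambda>v. val v t)"
  shows "computes k (BForall t \<phi>)"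
proof -
  let ?f = "\<lambda>v. of_bool (v 0 < val (\<lambda>i. v (Suc i)) t \<and> sat (\<lambda>_. A) v \<phi>) :: 'm"
  have "computable (Suc k) ?f"
    by (intro computable_conj computable_less computable_var computable_tail t \<phi>) simp
  then obtain e where e: "\<And>v y. Phi A e (tup k v) y \<longleftrightarrow> ?f (y \<triangleright> v) = 0 \<and> (\<forall>z<y. ?f (z \<triangleright> v) \<noteq> 0)"
    using computable_search[of k ?f] by blast
  have ex: "\<exists>y. Phi A e (tup k v) y" for v
  proof -
    let ?t = "subt (\<lambda>i. Var (Suc i)) t"
    have vt: "val (x \<triangleright> v) ?t = val v t" for x by (simp add: val_subt)
    obtain y where "sat (\<lambda>_. A) (y \<triangleright> v) (Neg (Conj (Less (Var 0) ?t) \<phi>))"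
      "\<And>z. z < y \<Longrightarrow> \<not> sat (\<lambda>_. A) (z \<triangleright> v) (Neg (Conj (Less (Var 0) ?t) \<phi>))"
      using least_dfn[of "Neg (Conj (Less (Var 0) ?t) \<phi>)" "val v t" v] b by (auto simp: vt)
    then show ?thesis unfolding e by (intro exI[of _ y]) (auto simp: vt)
  qed
  have sat: "sat (\<lambda>_. A) v (BForall t \<phi>) \<longleftrightarrow> \<not> y < val v t" if "Phi A e (tup k v) y" for v y
    using that unfolding e by (auto simp: not_less)
  define h where "h v = (SOME y. Phi A e (tup k v) y)" for v
  have h: "Phi A e (tup k v) (h v)" for v unfolding h_def using someI_ex[OF ex] .
  have "y = h v" if "Phi A e (tup k v) y" for v y
    using that h[of v] unfolding e by (metis linorder_neqE)
  with h have "computable k h" by (intro computableI[where e = e]) blast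
  then have "computable k (\<lambda>v. of_bool (\<not> h v < val v t))"
    by (intro computable_neg computable_less t)
  then show ?thesis using sat[OF h] by simp
qed

lemma computes_bounded: "bounded_fm \<phi> \<Longrightarrow> \<exists>K. \<forall>k\<ge>K. computes k \<phi>"
proof (induction \<phi>)
  case (Eq s t)
  obtain K L where "\<And>k. k \<ge> K \<Longrightarrow> computable k (\<lambda>v. val v s)" "\<And>k. k \<ge> L \<Longrightarrow> computable k (\<lambda>v. val v t)"
    using computable_val by meson
  then have "computable k (\<lambda>v. of_bool (\<not> val v s < val v t \<and> \<not> val v t < val v s))" if "k \<ge> max K L" for k
    using that by (intro computable_conj computable_neg computable_less) auto
  then show ?case by (intro exI[of _ "max K L"]) (simp add: order_eq_iff not_less conj_commute)
next
  case (Less s t)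
  obtain K L where "\<And>k. k \<ge> K \<Longrightarrow> computable k (\<lambda>v. val v s)" "\<And>k. k \<ge> L \<Longrightarrow> computable k (\<lambda>v. val v t)"
    using computable_val by meson
  then show ?case by (intro exI[of _ "max K L"]) (auto intro: computable_less)
next
  case (Mem t k)
  then show ?case using computable_val[of t] computable_oracle by simp blast
next
  case (Neg \<phi>)
  then obtain K where "\<And>k. k \<ge> K \<Longrightarrow> computes k \<phi>" by auto
  then have "computable k (\<lambda>v. of_bool (\<not> sat (\<lambda>_. A) v \<phi>))" if "k \<ge> K" for k
    using that by (intro computable_neg)
  then show ?case by auto
next
  case (Conj \<phi> \<psi>)
  then obtain K L where "\<And>k. k \<ge> K \<Longrightarrow> computes k \<phi>" "\<And>k. k \<ge> L \<Longrightarrow> computes k \<psi>" by auto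
  then show ?case by (intro exI[of _ "max K L"]) (auto simp del: of_bool_conj intro: computable_conj)
next
  case (Disj \<phi> \<psi>)
  then obtain K L where "\<And>k. k \<ge> K \<Longrightarrow> computes k \<phi>" "\<And>k. k \<ge> L \<Longrightarrow> computes k \<psi>" by auto
  then have "computable k (\<lambda>v. of_bool (\<not> (\<not> sat (\<lambda>_. A) v \<phi> \<and> \<not> sat (\<lambda>_. A) v \<psi>)))" if "k \<ge> max K L" for k
    using that by (intro computable_conj computable_neg) auto
  then show ?case by (intro exI[of _ "max K L"]) simp
next
  case (BForall t \<phi>)
  then obtain K L where "\<And>k. k \<ge> K \<Longrightarrow> computes k \<phi>" "\<And>k. k \<ge> L \<Longrightarrow> computable k (\<lambda>v. val v t)"
    using computable_val[of t] by auto
  with BForall.prems show ?case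
    by (intro exI[of _ "max K L"] allI impI computes_BForall) auto
next
  case (BExists t \<phi>)
  then obtain K L where KL: "\<And>k. k \<ge> K \<Longrightarrow> computes k \<phi>" "\<And>k. k \<ge> L \<Longrightarrow> computable k (\<lambda>v. val v t)"
    using computable_val[of t] by auto
  have "computable k (\<lambda>v. of_bool (\<not> sat (\<lambda>_. A) v (BForall t (Neg \<phi>))))" if "k \<ge> max K L" for k
    using BExists.prems that KL(1)[of "Suc k"] KL(2)[of k]
    by (intro computable_neg computes_BForall) (auto dest: computable_neg)
  then show ?case by (intro exI[of _ "max K L"]) simp
qed auto

text \<open>
  The index \<open>q v\<close> ignores its argument and applies the search for a witness to \<open>tup k (env E v)\<close>;
  hence membership of \<open>q v\<close> in the jump, a self-application, does not depend on \<open>q v\<close>.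
\<close>

lemma jump_complete:
  assumes "Sg (\<lambda>_. A) 1 P"
  obtains q where "polyn q" "\<And>v. P v \<longleftrightarrow> q v \<in> jump A"
proof -
  obtain R where R: "Bd (\<lambda>_. A) (\<lambda>v. R (v 0) (\<lambda>i. v (Suc i)))" "\<And>v. P v \<longleftrightarrow> (\<exists>y. R y v)"
    using Sg_Suc_contract[OF clos_0, of "\<lambda>_. A" P] assms by (auto simp: Pi_0)
  obtain \<phi> E where \<phi>: "bounded_fm \<phi>" "\<And>x v. R x v = sat (\<lambda>_. A) (x \<triangleright> env E v) \<phi>"
    using dfn_open[OF R(1)] by auto
  obtain k where "computes (Suc k) (Neg \<phi>)"
    using computes_bounded[of "Neg \<phi>"] \<phi>(1) by (meson bounded_fm.simps(4) le_Suc_eq order_refl)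
  then obtain e where e: "\<And>v y. Phi A e (tup k v) y \<longleftrightarrow>
      sat (\<lambda>_. A) (y \<triangleright> v) \<phi> \<and> (\<forall>z<y. \<not> sat (\<lambda>_. A) (z \<triangleright> v) \<phi>)"
    using computable_search by fastforce
  have ex: "(\<exists>y. Phi A e (tup k w) y) \<longleftrightarrow> (\<exists>y. sat (\<lambda>_. A) (y \<triangleright> w) \<phi>)" for w
    unfolding e using least_dfn[OF \<phi>(1)] by blast
  define q where "q v = cpair 3 (cpair e (cpair 0 (tup k (env E v))))" for v
  have "polyn q"
    unfolding q_def[abs_def] by (intro polyn_cpair polyn_const polyn_tup polyn_env)
  moreover have "P v \<longleftrightarrow> q v \<in> jump A" for v
  proof -
    have "Phi A (q v) x y \<longleftrightarrow> Phi A e (tup k (env E v)) y" for x y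
      by (simp add: q_def Phi_comp Phi_const)
    then have "q v \<in> jump A \<longleftrightarrow> (\<exists>y. Phi A e (tup k (env E v)) y)"
      unfolding jump_def by blast
    then show ?thesis by (simp add: R(2) \<phi>(2) ex)
  qed
  ultimately show ?thesis using that by blast
qed

text \<open>One query of \<open>jump A\<close> decides a \<Pi>1 predicate; this is what lowers the
  level by one in passing to the jump.\<close>

lemma Pi_1_Bd_jump: "Pi (\<lambda>_. A) 1 P \<Longrightarrow> Bd (\<lambda>_. jump A) P"
proof -
  assume "Pi (\<lambda>_. A) 1 P"
  from jump_complete[OF Pi_neg[OF this]] obtain q where q: "polyn q" "\<And>v. \<not> P v \<longleftrightarrow> q v \<in> jump A" by blast
  have "Bd (\<lambda>_. jump A) (\<lambda>v. \<not> q v \<in> jump A)" by (intro Bd_neg Bd_mem q(1))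
  then show ?thesis by (simp flip: q(2))
qed

lemma Sg_2_Sg_1_jump: "Sg (\<lambda>_. A) 2 P \<Longrightarrow> Sg (\<lambda>_. jump A) 1 P"
proof -
  assume "Sg (\<lambda>_. A) 2 P"
  then obtain R where R: "Pi (\<lambda>_. A) 1 (\<lambda>v. R (v 0) (\<lambda>i. v (Suc i)))" "\<And>v. P v \<longleftrightarrow> (\<exists>y. R y v)"
    using Sg_Suc_contract[OF clos1, of P] by (auto simp: numeral_2_eq_2)
  have "Sg (\<lambda>_. jump A) 1 (\<lambda>v. \<exists>y. R y v)"
    unfolding One_nat_def by (intro Sg_ex Bd_Sg Pi_1_Bd_jump R(1))
  moreover have "P = (\<lambda>v. \<exists>y. R y v)" using R(2) by (rule ext)
  ultimately show ?thesis by simp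
qed

end

section \<open>The complexity of the jump, and definability of sets\<close>

lemma jump_Sg_1: "Sg (\<lambda>_. G) 1 (\<lambda>v. v 0 \<in> jump G)"
proof -
  have "Sg (\<lambda>_. G) (Suc 0) (\<lambda>v. \<exists>y d n. computation G d n \<and> (\<exists>i<n. recorded d i (v 0) (v 0) y))"
    by (intro Sg_ex Bd_Sg Bd_intros Bd_computation[where S = "\<lambda>_. G"] Bd_recorded)
  then show ?thesis by (simp add: jump_def Phi_def)
qed

lemma definable_Sg: "sigma_definable n A X \<Longrightarrow> Sg (\<lambda>_. A) n (\<lambda>v. v 0 \<in> X)"
  unfolding sigma_definable_def by (auto intro: dfn_formula)

lemma Sg_definable: "Sg (\<lambda>_. A) n (\<lambda>v. v 0 \<in> X) \<Longrightarrow> sigma_definable n A X"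
  and Pi_definable: "Pi (\<lambda>_. A) n (\<lambda>v. v 0 \<in> X) \<Longrightarrow> pi_definable n A X"
proof -
  have *: "\<exists>\<phi> v. C \<phi> \<and> X = {x. sat (\<lambda>_. A) (x \<triangleright> v) \<phi>}"
    if "dfn (\<lambda>_. A) C (\<lambda>v. v 0 \<in> X)" "\<And>h \<tau> \<phi>. C \<phi> \<Longrightarrow> C (sub h \<tau> \<phi>)" for C
  proof -
    obtain \<phi> E where "C \<phi>" "\<And>x v. (x \<in> X) = sat (\<lambda>_. A) (x \<triangleright> env E v) \<phi>"
      using dfn_open[of "\<lambda>_. A" C "\<lambda>x v. x \<in> X"] \<open>dfn (\<lambda>_. A) C (\<lambda>v. v 0 \<in> X)\<close>
        \<open>\<And>h \<tau> \<phi>. C \<phi> \<Longrightarrow> C (sub h \<tau> \<phi>)\<close> by blast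
    then show ?thesis by (intro exI[of _ \<phi>] exI[of _ "env E (\<lambda>_. 0)"]) auto
  qed
  show "Sg (\<lambda>_. A) n (\<lambda>v. v 0 \<in> X) \<Longrightarrow> sigma_definable n A X"
    unfolding sigma_definable_def using *[of "sigma_fm n"] sigma_pi_sub(1) by blast
  show "Pi (\<lambda>_. A) n (\<lambda>v. v 0 \<in> X) \<Longrightarrow> pi_definable n A X"
    unfolding pi_definable_def using *[of "pi_fm n"] sigma_pi_sub(2) by blast
qed

section \<open>The jump of a generic extension\<close>

lemma double_inj: "(x::'m::pa_minus) + x = z + z \<longleftrightarrow> x = z"
  by (metis add_less_le_mono linorder_neqE order_less_imp_le order_less_irrefl)

lemma double_neq_odd: "(x::'m::pa_minus) + x \<noteq> z + z + 1"
proof (cases "x \<le> z")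
  case True
  then have "x + x \<le> z + z" by (rule add_mono) (rule True)
  then show ?thesis using less_succ[of "z + z"] by auto
next
  case False
  then have "z + 1 \<le> x" by (simp add: less_iff_succ_le[symmetric])
  then have "(z + z + 1) + 1 \<le> x + x" using add_mono[of "z + 1" x "z + 1" x] by (simp add: ac_simps)
  then show ?thesis using less_succ[of "z + z + 1"] by auto
qed

text \<open>Both sets can be read off the even and the odd half of the join by atomic
  formulas.\<close>

lemma adjoin_contains:
  assumes "A \<in> \<X>" shows "A \<in> adjoin \<X> G" and "G \<in> adjoin \<X> G"
proof -
  have *: "delta_definable 1 (join A G) X" if "Bd (\<lambda>_. join A G) (\<lambda>v. v 0 \<in> X)" for X
    using that unfolding delta_definable_def by (auto intro: Sg_definable Pi_definable Bd_Sg Bd_Pi)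
  have "x + x \<in> join A G \<longleftrightarrow> x \<in> A" "x + x + 1 \<in> join A G \<longleftrightarrow> x \<in> G" for x
    unfolding join_def using double_neq_odd[of x] double_neq_odd[of _ x, symmetric]
    by (auto simp: mult_2 double_inj)
  moreover have "Bd (\<lambda>_. join A G) (\<lambda>v. v 0 + v 0 \<in> join A G)" "Bd (\<lambda>_. join A G) (\<lambda>v. v 0 + v 0 + 1 \<in> join A G)"
    by (intro Bd_mem polyn_intros)+
  ultimately show "A \<in> adjoin \<X> G" "G \<in> adjoin \<X> G"
    unfolding adjoin_def using * assms by auto
qed

lemma BSigma_bs2:
  assumes "BSigma 2 \<X>" "range S \<subseteq> \<X>" shows "bs2 S"
proof
  show "coll S 2" using assms unfolding BSigma_def sigma_collection_def coll_def by blast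
  fix \<phi> w x
  assume "bounded_fm \<phi>" "sat S (0 \<triangleright> w) \<phi>" "\<And>x. sat S (x \<triangleright> w) \<phi> \<Longrightarrow> sat S ((x + 1) \<triangleright> w) \<phi>"
  then show "sat S (x \<triangleright> w) \<phi>"
    using assms unfolding BSigma_def sigma_induction_def sigma_fm_0 by blast
qed

section \<open>Normal forms, and definability relative to a \<open>\<Delta>\<^sub>2\<close>
  set\<close>

lemma polyn_val: "polyn (\<lambda>v. val (env E v) t)"
  unfolding polyn_def by blast

context bs2
begin

lemma Sg_3_normal_form:
  assumes "Sg S 3 (\<lambda>v. X (v 0))"
  obtains \<theta> where "D2 S (\<lambda>v. \<theta> (v 0) (v 1) (v 2))" "\<And>x. X x \<longleftrightarrow> (\<exists>y. \<forall>z. \<theta> x y z)"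
proof -
  obtain R where R: "Pi S 2 (\<lambda>v. R (v 0) (v 1))" "\<And>x. X x \<longleftrightarrow> (\<exists>y. R y x)"
    using Sg_Suc_contract_binary[OF clos2, of X] assms by (auto simp: numeral_3_eq_3 numeral_2_eq_2)
  obtain T where T: "Pi S 1 (\<lambda>v. T (v 0) (\<lambda>i. v (Suc i)))" "\<And>v. \<not> R (v 0) (v 1) \<longleftrightarrow> (\<exists>z. T z v)"
    using Sg_Suc_contract[OF clos1, of "\<lambda>v. \<not> R (v 0) (v 1)"] Pi_neg[OF R(1)]
    by (auto simp: numeral_2_eq_2)
  define \<theta> where "\<theta> x y z \<longleftrightarrow> \<not> T z (y \<triangleright> x \<triangleright> (\<lambda>_. 0))" for x y z
  let ?F = "\<lambda>i. case i of 0 \<Rightarrow> Inl 2 | Suc i \<Rightarrow> (case i of 0 \<Rightarrow> Inl 1 | Suc i \<Rightarrow> (case i of 0 \<Rightarrow> Inl 0 | Suc i \<Rightarrow> Inr (0 :: 'm)))"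
  have "env ?F u 0 = u 2" "(\<lambda>i. env ?F u (Suc i)) = u 1 \<triangleright> u 0 \<triangleright> (\<lambda>_. 0)" for u
    by (auto simp: env_def fun_eq_iff scons_def split: nat.split)
  then have "Pi S 1 (\<lambda>v. T (v 2) (v 1 \<triangleright> v 0 \<triangleright> (\<lambda>_. 0)))"
    using dfn_env[OF T(1), of ?F] by simp
  then have "D2 S (\<lambda>v. \<theta> (v 0) (v 1) (v 2))"
    unfolding \<theta>_def by (intro D2_neg D2_Pi1)
  moreover have "X x \<longleftrightarrow> (\<exists>y. \<forall>z. \<theta> x y z)" for x
    using R(2)[of x] T(2)[of "y \<triangleright> x \<triangleright> (\<lambda>_. 0)" for y] unfolding \<theta>_def by auto
  ultimately show ?thesis using that by blast
qed

text \<open>\<open>D2\<close> is closed under Boolean operations and bounded quantifiers, so a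
  \<open>D2\<close> set may be substituted for the set variables. \<open>E\<close> is kept arbitrary
  because it grows under each quantifier.\<close>

lemma D2_bounded_in:
  assumes G: "D2 S (\<lambda>v. v 0 \<in> G)" and "bounded_fm \<phi>"
  shows "D2 S (\<lambda>v. sat (\<lambda>_. G) (env E v) \<phi>)"
  using assms(2)
proof (induction \<phi> arbitrary: E)
  case (BForall t \<phi>)
  let ?E = "\<lambda>i. case i of 0 \<Rightarrow> Inl 0 | Suc i \<Rightarrow> map_sum Suc id (E i)"
  have "env ?E v = v 0 \<triangleright> env E (\<lambda>i. v (Suc i))" for v
    by (auto simp: env_def scons_def fun_eq_iff split: nat.split sum.split)
  then have "D2 S (\<lambda>v. sat (\<lambda>_. G) (v 0 \<triangleright> env E (\<lambda>i. v (Suc i))) \<phi>)"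
    using BForall.IH[of ?E] BForall.prems by simp
  then show ?case unfolding sat.simps by (intro D2_ball polyn_val)
next
  case (BExists t \<phi>)
  let ?E = "\<lambda>i. case i of 0 \<Rightarrow> Inl 0 | Suc i \<Rightarrow> map_sum Suc id (E i)"
  have "env ?E v = v 0 \<triangleright> env E (\<lambda>i. v (Suc i))" for v
    by (auto simp: env_def scons_def fun_eq_iff split: nat.split sum.split)
  then have "D2 S (\<lambda>v. sat (\<lambda>_. G) (v 0 \<triangleright> env E (\<lambda>i. v (Suc i))) \<phi>)"
    using BExists.IH[of ?E] BExists.prems by simp
  then show ?case unfolding sat.simps by (intro D2_bex polyn_val)
next
  case (Mem t k)
  show ?case unfolding sat.simps using D2_sub1[OF G polyn_val] .
next
  case (Eq s t)
  show ?case unfolding sat.simps by (intro D2_Bd Bd_eq polyn_val)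
next
  case (Less s t)
  show ?case unfolding sat.simps by (intro D2_Bd Bd_less polyn_val)
next
  case (Neg \<phi>)
  then show ?case unfolding sat.simps bounded_fm.simps by (intro D2_neg)
next
  case (Conj \<phi> \<psi>)
  then show ?case unfolding sat.simps bounded_fm.simps by (intro D2_conj) simp_all
next
  case (Disj \<phi> \<psi>)
  then show ?case unfolding sat.simps bounded_fm.simps by (intro D2_disj) simp_all
qed simp_all

lemma Sg_1_in:
  assumes G: "D2 S (\<lambda>v. v 0 \<in> G)" and P: "Sg (\<lambda>_. G) 1 P"
  shows "Sg S 2 P"
proof -
  obtain R where R: "Bd (\<lambda>_. G) (\<lambda>v. R (v 0) (\<lambda>i. v (Suc i)))" "\<And>v. P v \<longleftrightarrow> (\<exists>y. R y v)"
    using Sg_Suc_contract[OF clos_0, of "\<lambda>_. G" P] P by (auto simp: Pi_0)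
  obtain \<phi> E where \<phi>: "bounded_fm \<phi>" "\<And>v. R (v 0) (\<lambda>i. v (Suc i)) = sat (\<lambda>_. G) (env E v) \<phi>"
    using R(1) unfolding dfn_def by blast
  have "D2 S (\<lambda>v. R (v 0) (\<lambda>i. v (Suc i)))"
    unfolding \<phi>(2) using D2_bounded_in[OF G \<phi>(1)] .
  then have "Sg S 2 (\<lambda>v. \<exists>y. R y v)" by (intro Sg2_ex D2_Sg)
  moreover have "P = (\<lambda>v. \<exists>y. R y v)" using R(2) by (rule ext)
  ultimately show ?thesis by simp
qed

end

text \<open>The argument with types, with \<open>\<theta>\<close> supplied by the normal form of
  \<open>X\<close>.\<close>

lemma (in cut) D2_of_Sg_3:
  assumes "D2 S (\<lambda>v. X (v 0))" "Sg A 3 (\<lambda>v. X (v 0))"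
  shows "D2 A (\<lambda>v. X (v 0))"
proof -
  obtain \<theta> where \<theta>: "D2 A (\<lambda>v. \<theta> (v 0) (v 1) (v 2))" "\<And>x. X x \<longleftrightarrow> (\<exists>y. \<forall>z. \<theta> x y z)"
    using a.Sg_3_normal_form[OF assms(2)] by blast
  interpret cut_types \<rho> I b S A \<theta>
    by unfold_locales (rule \<theta>)
  show ?thesis using D2_transfer[OF assms(1) \<theta>(2)] .
qed

text \<open>The \<Sigma>2 predicate \<open>J\<close> that refutes induction need not be downward
  closed. \<open>I\<close> consists of those \<open>x\<close> up to which a single bound serves for
  witnesses of \<open>J\<close>; it is downward closed and still inductive, because \<open>J\<close>
  is.\<close>

lemma cut_exists:
  assumes "bs2 S" "bs2 (\<lambda>_. A)" "S 0 = A" "\<not> sigma_induction 2 {A}"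
  shows "\<exists>\<rho> I b. cut S (\<lambda>_. A) \<rho> I b"
proof -
  interpret s: bs2 S by fact
  interpret a: bs2 "\<lambda>_. A" by fact
  obtain \<phi> S' v b where \<phi>: "sigma_fm 2 \<phi>" "range S' \<subseteq> {A}"
    and ind: "sat S' (0 \<triangleright> v) \<phi>" "\<forall>x. sat S' (x \<triangleright> v) \<phi> \<longrightarrow> sat S' ((x + 1) \<triangleright> v) \<phi>"
    and b: "\<not> sat S' (b \<triangleright> v) \<phi>"
    using assms(4) unfolding sigma_induction_def not_all not_imp by (elim exE conjE) rule
  have S': "S' = (\<lambda>_. A)" using \<phi>(2) by (auto simp: fun_eq_iff)
  define J where "J x \<longleftrightarrow> sat (\<lambda>_. A) (x \<triangleright> v) \<phi>" for x
  have "Sg (\<lambda>_. A) 2 (\<lambda>v. J (v 0))"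
    unfolding J_def by (rule dfn_formula[where C = "sigma_fm 2", OF \<phi>(1)])
  then obtain R where R: "Pi (\<lambda>_. A) 1 (\<lambda>v. R (v 0) (v 1))" "\<And>x. J x \<longleftrightarrow> (\<exists>y. R y x)"
    using Sg_Suc_contract_binary[OF a.clos1, of J] by (auto simp: numeral_2_eq_2)
  define \<rho> where "\<rho> x u \<longleftrightarrow> (\<forall>z<x+1. \<exists>y<u. R y z)" for x u
  define I where "I x \<longleftrightarrow> (\<exists>u. \<rho> x u)" for x
  have "cut S (\<lambda>_. A) \<rho> I b"
  proof
    show "D2 S P" if "D2 (\<lambda>_. A) P" for P
      using that unfolding D2_def
      by (auto intro!: dfn_set_subst[of "\<lambda>_. A" _ _ S "\<lambda>_. 0"] sigma_pi_sub simp: assms(3))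
    show "D2 (\<lambda>_. A) (\<lambda>v. \<rho> (v 0) (v 1))"
      unfolding \<rho>_def by (intro a.D2_intros D2_sub2[OF D2_Pi1[OF R(1)]])
    show "I x \<longleftrightarrow> (\<exists>u. \<rho> x u)" for x by (rule I_def)
    show "\<rho> y w" if "\<rho> x u" "y \<le> x" "u \<le> w" for x y u w
      using that unfolding \<rho>_def less_succ_iff by (meson order_less_le_trans order_trans)
    show "I 0"
    proof -
      obtain y where "R y 0" using ind(1) R(2) unfolding S' J_def by blast
      then have "\<rho> 0 (y + 1)" using less_succ[of y] by (auto simp: \<rho>_def intro!: exI[of _ y])
      then show ?thesis unfolding I_def by blast
    qed
    show "I (x + 1)" if "I x" for x
    proof -
      obtain u where u: "\<rho> x u" using \<open>I x\<close> unfolding I_def by blast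
      then have "J x" using R(2)[of x] less_succ[of x] unfolding \<rho>_def by blast
      then have "J (x + 1)" using ind(2) unfolding S' J_def by blast
      then obtain y where y: "R y (x + 1)" using R(2) by blast
      have "\<rho> (x + 1) (max u (y + 1))"
        unfolding \<rho>_def
      proof (intro allI impI)
        fix z assume "z < x + 1 + 1"
        then consider "z < x + 1" | "z = x + 1" by (auto simp: less_succ_iff[of z "x + 1"] order_le_less)
        then show "\<exists>y'<max u (y + 1). R y' z"
        proof cases
          case 1
          with u show ?thesis unfolding \<rho>_def by (meson less_max_iff_disj)
        next
          case 2
          with y less_succ[of y] show ?thesis by (meson less_max_iff_disj)
        qed
      qed
      then show ?thesis unfolding I_def by blast
    qed
    show "\<not> I b"
      using b R(2)[of b] less_succ[of b] unfolding I_def \<rho>_def S' J_def by blast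
  qed
  then show ?thesis by blast
qed

theorem theorem3p1:
  fixes \<X> :: "'m::pa_minus set set" and A G :: "'m set"
  assumes "BSigma2_model \<X>"
    and "A \<in> \<X>"
    and "\<not> sigma_induction 2 {A}"
    and "sigma_definable 3 A G"
    and "BSigma 2 (adjoin \<X> G)"
  shows "jump G \<le>\<^sub>T jump A"
proof -
  \<comment> \<open>Set variable 0 denotes \<open>A\<close> and all others denote \<open>G\<close>,
    so both are available as parameters.\<close>
  define S where "S k = (if k = 0 then A else G)" for k :: nat
  note in_adjoin = adjoin_contains[OF assms(2), of G]
  have S: "bs2 S" and A: "bs2 (\<lambda>_. A)"
    by (rule BSigma_bs2[OF assms(5)], use in_adjoin in \<open>auto simp: S_def\<close>)+
  interpret a: one_set A using A by (simp add: one_set_def)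
  obtain \<rho> I b where "cut S (\<lambda>_. A) \<rho> I b"
    using cut_exists[OF S A _ assms(3)] by (auto simp: S_def)
  then interpret cut S "\<lambda>_. A" \<rho> I b .
  have "D2 S (\<lambda>v. v 0 \<in> S 1)"
    by (intro D2_Bd Bd_mem polyn_intros)
  \<comment> \<open>First application: \<open>G\<close> is a set parameter of \<open>S\<close> and
    is \<Sigma>3 in \<open>A\<close>.\<close>
  then have G: "D2 (\<lambda>_. A) (\<lambda>v. v 0 \<in> G)"
    using D2_of_Sg_3[of "\<lambda>x. x \<in> G"] definable_Sg[OF assms(4)] by (simp add: S_def)
  \<comment> \<open>Second application: \<open>G\<close> is now \<Delta>2 in \<open>A\<close>, so
    its jump, being \<Sigma>1 in \<open>G\<close>, is \<Sigma>2 and hence \<Sigma>3 in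
    \<open>A\<close>.\<close>
  have "Sg (\<lambda>_. A) 3 (\<lambda>v. v 0 \<in> jump G)"
    using Sg_mono[OF a.Sg_1_in[OF G jump_Sg_1], of 3] by simp
  moreover have "D2 S (\<lambda>v. v 0 \<in> jump G)"
    by (rule D2_Sg1, rule dfn_set_subst[OF jump_Sg_1, of G S "\<lambda>_. 1"]) (auto simp: S_def intro: sigma_pi_sub)
  ultimately have "D2 (\<lambda>_. A) (\<lambda>v. v 0 \<in> jump G)"
    using D2_of_Sg_3[of "\<lambda>x. x \<in> jump G"] by blast
  \<comment> \<open>The set and its complement are both \<Sigma>2 in \<open>A\<close>, hence both
    \<Sigma>1 in the jump of \<open>A\<close>.\<close>
  then have "Sg (\<lambda>_. jump A) 1 (\<lambda>v. v 0 \<in> jump G)" "Pi (\<lambda>_. jump A) 1 (\<lambda>v. v 0 \<in> jump G)"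
    unfolding Pi_iff_Sg D2_def by (blast intro: a.Sg_2_Sg_1_jump)+
  then show ?thesis
    unfolding turing_le_def delta_definable_def by (blast intro: Sg_definable Pi_definable)
qed

end
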